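(* Let $k$ be an algebraically closed field and let $A$ be a Frobenius $k$-algebra whose Nakayama automorphism $\mathfrak N$ has finite order not divisible by the characteristic of $k$. Then the BV-operator $\partial B_{\mathfrak N}^*\partial^{-1}$ of Lambre–Zhou–Zimmermann and the BV-operator $\Delta$ of Volkov on $HH^\bullet(A)$ are equal; indeed $$\partial B_{\mathfrak N}^*\partial^{-1}=Z_*^{-1}\,\overline B_{\mathfrak N}\,Z_*=\Delta.$$
   Context: Conventions. $\otimes=\otimes_k$; algebras are associative and unital; $(-)^*=\mathrm{Hom}_k(-,k)$. For an $A$-bimodule $M$, $H^\bullet(A,M)$ (resp. $H_\bullet(A,M)$) is Hochschild cohomology (resp. homology), computed by the standard complexes $\mathrm{Hom}_k(A^{\otimes n},M)$ (resp. $M\otimes A^{\otimes n}$); $HH^\bullet(A)=H^\bullet(A,A)$. A Frobenius algebra is a finite-dimensional $k$-algebra $A$ with a non-degenerate associative ($\langle ab,c\rangle=\langle a,bc\rangle$) bilinear form $\langle-,-\rangle:A\times A\to k$. Its Nakayama automorphism is the algebra automorphism $\mathfrak N:A\to A$ with $\langle a,-\rangle=\langle-,\mathfrak N(a)\rangle$ for all $a\in A$. $A_{\mathfrak N}$ is the $A$-bimodule with underlying space $A$ and actions $axb=a\,x\,\mathfrak N(b)$ (products in $A$ on the right-hand side). $A_{\mathfrak N}^*$ has the bimodule structure $(afb)(c)=f(bc\,\mathfrak N(a))$. The map $Z:A\to A_{\mathfrak N}^*$, $Z(a)=\langle a,-\rangle$, is an isomorphism of $A$-bimodules, and $Z_*:HH^\bullet(A)\to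 H^\bullet(A,A_{\mathfrak N}^* )$ is the isomorphism induced by composition with $Z$. Operators. $B_{\mathfrak N}:H_\bullet(A,A_{\mathfrak N})\to H_{\bullet+1}(A,A_{\mathfrak N})$ sends $[a_0\otimes\cdots\otimes a_n]$ to $\big[\sum_{i=0}^n(-1)^{in}\,1\otimes a_i\otimes\cdots\otimes a_n\otimes a_0\otimes\mathfrak N(a_1)\otimes\cdots\otimes\mathfrak N(a_{i-1})\big]$, and $B_{\mathfrak N}^*$ is its $k$-dual. $\partial:H_\bullet(A,A_{\mathfrak N})^*\to HH^\bullet(A)$ is the isomorphism with inverse $\partial^{-1}([f])([a_0\otimes\cdots\otimes a_n])=(-1)^n\langle a_0,f(a_1\otimes\cdots\otimes a_n)\rangle$ for $[f]\in HH^n(A)$. The operator $\overline B_{\mathfrak N}:H^n(A,A_{\mathfrak N}^* )\to H^{n-1}(A,A_{\mathfrak N}^* )$ is $$\overline B_{\mathfrak N}([f])(a_1\otimes\cdots\otimes a_{n-1})(a_0)=\sum_{i=0}^{n-1}(-1)^{i(n-1)}f(a_i\otimes\cdots\otimes a_{n-1}\otimes a_0\otimes\mathfrak N(a_1)\otimes\cdots\otimes\mathfrak N(a_{i-1}))(1).$$ Volkov's operator $\Delta:HH^n(A)\to HH^{n-1}(A)$ is defined by $$\langle\Delta f(a_1\otimes\cdots\otimes a_{n-1}),a_0\rangle=\sum_{i=0}^{n-1}(-1)^{i(n-1)}\langle f(a_i\otimes\cdots\otimes a_{n-1}\otimes a_0\otimes\mathfrak N(a_1)\otimes\cdots\otimes\mathfrak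 N(a_{i-1})),1\rangle.$$
   Formalization: ∂^{-1} is taken as ⟨f(a_1⊗…⊗a_n),a_0⟩, without sign and with arguments swapped, as the printed formula gives −Δ or is ill-defined on homology; the i=0 summand is read as a_0⊗N(a_1)⊗…⊗N(a_n); the operators are evaluated on N-invariant representatives. *)

theory Defs
  imports
    "HOL-Computational_Algebra.Polynomial"
    "HOL-Library.Poly_Mapping"
    "HOL-Library.Function_Algebras"
    "HOL-Library.FuncSet"
begin

section \<open>Frobenius algebras and Nakayama automorphisms\<close>

text \<open>
  The sort \<open>{ring, monoid_mult}\<close> is that of associative unital rings, the zero ring included.
\<close>

locale frobenius_algebra = vector_space scale
  for scale :: "'k::field \<Rightarrow> 'a::{ring, monoid_mult} \<Rightarrow> 'a" +
  fixes form :: "'a \<Rightarrow> 'a \<Rightarrow> 'k"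
  assumes scale_mult_left: "scale t (a * b) = scale t a * b"
    and scale_mult_right: "scale t (a * b) = a * scale t b"
    and finite_dim: "\<exists>S. finite S \<and> span S = UNIV"
    and form_linear_left: "Vector_Spaces.linear scale (*) (\<lambda>a. form a b)"
    and form_linear_right: "Vector_Spaces.linear scale (*) (form a)"
    and form_assoc: "form (a * b) c = form a (b * c)"
    and form_nondegenerate_left: "(\<And>b. form a b = 0) \<Longrightarrow> a = 0"
    and form_nondegenerate_right: "(\<And>a. form a b = 0) \<Longrightarrow> b = 0"

definition algebra_automorphism ::
    "('k::field \<Rightarrow> 'a::{ring, monoid_mult} \<Rightarrow> 'a) \<Rightarrow> ('a \<Rightarrow> 'a) \<Rightarrow> bool" where
  "algebra_automorphism scale N \<longleftrightarrow>
     Vector_Spaces.linear scale scale N \<and> bij N \<and> N 1 = 1 \<and> (\<forall>a b. N (a * b) = N a * N b)"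

definition nakayama_automorphism ::
    "('k::field \<Rightarrow> 'a::{ring, monoid_mult} \<Rightarrow> 'a) \<Rightarrow> ('a \<Rightarrow> 'a \<Rightarrow> 'k) \<Rightarrow> ('a \<Rightarrow> 'a) \<Rightarrow> bool" where
  "nakayama_automorphism scale form N \<longleftrightarrow>
     algebra_automorphism scale N \<and> (\<forall>a b. form a b = form b (N a))"

definition has_finite_order :: "('a \<Rightarrow> 'a) \<Rightarrow> bool" where
  "has_finite_order N \<longleftrightarrow> (\<exists>m>0. N ^^ m = id)"

definition automorphism_order :: "('a \<Rightarrow> 'a) \<Rightarrow> nat" where
  "automorphism_order N = (LEAST m. m > 0 \<and> N ^^ m = id)"


section \<open>Bimodules\<close>

record ('k, 'a, 'm) bimodule =
  carr :: "'m set"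
  scl :: "'k \<Rightarrow> 'm \<Rightarrow> 'm"
  lact :: "'a \<Rightarrow> 'm \<Rightarrow> 'm"
  ract :: "'m \<Rightarrow> 'a \<Rightarrow> 'm"

definition regular_bimodule ::
    "('k::field \<Rightarrow> 'a::{ring, monoid_mult} \<Rightarrow> 'a) \<Rightarrow> ('k, 'a, 'a) bimodule" where
  "regular_bimodule scale =
     \<lparr>carr = UNIV, scl = scale, lact = (\<lambda>a x. a * x), ract = (\<lambda>x b. x * b)\<rparr>"

definition twisted_bimodule ::
    "('k::field \<Rightarrow> 'a::{ring, monoid_mult} \<Rightarrow> 'a) \<Rightarrow> ('a \<Rightarrow> 'a) \<Rightarrow> ('k, 'a, 'a) bimodule" where
  "twisted_bimodule scale N =
     \<lparr>carr = UNIV, scl = scale, lact = (\<lambda>a x. a * x), ract = (\<lambda>x b. x * N b)\<rparr>"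

definition twisted_dual_bimodule ::
    "('k::field \<Rightarrow> 'a::{ring, monoid_mult} \<Rightarrow> 'a) \<Rightarrow> ('a \<Rightarrow> 'a) \<Rightarrow> ('k, 'a, 'a \<Rightarrow> 'k) bimodule" where
  "twisted_dual_bimodule scale N =
     \<lparr>carr = {\<phi>. Vector_Spaces.linear scale (*) \<phi>},
      scl = (\<lambda>t \<phi> c. t * \<phi> c),
      lact = (\<lambda>a \<phi> c. \<phi> (c * N a)),
      ract = (\<lambda>\<phi> b c. \<phi> (b * c))\<rparr>"


section \<open>Classes\<close>

definition coset :: "'v::ab_group_add set \<Rightarrow> 'v \<Rightarrow> 'v set" where
  "coset B x = {x + b | b. b \<in> B}"

text \<open>
  The map of (co)homology spaces that a map \<open>F\<close> of (co)chains induces, when classes are to be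
  represented by elements of \<open>I\<close>: a class \<open>c\<close> goes to the class \<open>d \<in> H\<close> that contains \<open>F x\<close> for
  every representative \<open>x \<in> c \<inter> I\<close>.
\<close>

definition induced_map ::
    "('u \<Rightarrow> 'v) \<Rightarrow> 'u set \<Rightarrow> 'v set set \<Rightarrow> 'u set \<Rightarrow> 'v set" where
  "induced_map F I H c = (THE d. d \<in> H \<and> F ` (c \<inter> I) \<subseteq> d)"


section \<open>Hochschild cohomology\<close>

text \<open>
  An element of \<open>Hom(A\<^sup>\<otimes>\<^sup>n, M)\<close> is a multilinear map on lists of length \<open>n\<close>, extended by \<open>0\<close> to
  the other lists.
\<close>

definition cochains ::
    "('k::field \<Rightarrow> 'a::{ring, monoid_mult} \<Rightarrow> 'a) \<Rightarrow> ('k, 'a, 'm::ab_group_add) bimodule \<Rightarrow> nat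
      \<Rightarrow> ('a list \<Rightarrow> 'm) set" where
  "cochains scale M n =
     {f. (\<forall>xs. length xs = n \<longrightarrow> f xs \<in> carr M) \<and>
         (\<forall>xs. length xs \<noteq> n \<longrightarrow> f xs = 0) \<and>
         (\<forall>xs ys a b. length xs + length ys + 1 = n \<longrightarrow>
            f (xs @ (a + b) # ys) = f (xs @ a # ys) + f (xs @ b # ys)) \<and>
         (\<forall>xs ys a t. length xs + length ys + 1 = n \<longrightarrow>
            f (xs @ scale t a # ys) = scl M t (f (xs @ a # ys)))}"

definition mult_at :: "nat \<Rightarrow> 'a::times list \<Rightarrow> 'a list" where
  "mult_at i xs = take i xs @ (xs ! i * xs ! Suc i) # drop (Suc (Suc i)) xs"

definition hoch_coboundary ::
    "('k::field, 'a::{ring, monoid_mult}, 'm::ab_group_add) bimodule \<Rightarrow> nat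
      \<Rightarrow> ('a list \<Rightarrow> 'm) \<Rightarrow> ('a list \<Rightarrow> 'm)" where
  "hoch_coboundary M n f xs =
     (if length xs = Suc n
      then lact M (hd xs) (f (tl xs))
         + (\<Sum>i<n. scl M ((-1) ^ Suc i) (f (mult_at i xs)))
         + scl M ((-1) ^ Suc n) (ract M (f (butlast xs)) (last xs))
      else 0)"

definition cocycles ::
    "('k::field \<Rightarrow> 'a::{ring, monoid_mult} \<Rightarrow> 'a) \<Rightarrow> ('k, 'a, 'm::ab_group_add) bimodule \<Rightarrow> nat
      \<Rightarrow> ('a list \<Rightarrow> 'm) set" where
  "cocycles scale M n = {f \<in> cochains scale M n. hoch_coboundary M n f = 0}"

definition coboundaries ::
    "('k::field \<Rightarrow> 'a::{ring, monoid_mult} \<Rightarrow> 'a) \<Rightarrow> ('k, 'a, 'm::ab_group_add) bimodule \<Rightarrow> nat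
      \<Rightarrow> ('a list \<Rightarrow> 'm) set" where
  "coboundaries scale M n =
     (case n of 0 \<Rightarrow> {0} | Suc m \<Rightarrow> hoch_coboundary M m ` cochains scale M m)"

definition hoch_cohomology ::
    "('k::field \<Rightarrow> 'a::{ring, monoid_mult} \<Rightarrow> 'a) \<Rightarrow> ('k, 'a, 'm::ab_group_add) bimodule \<Rightarrow> nat
      \<Rightarrow> ('a list \<Rightarrow> 'm) set set" where
  "hoch_cohomology scale M n = coset (coboundaries scale M n) ` cocycles scale M n"

abbreviation HH ::
    "('k::field \<Rightarrow> 'a::{ring, monoid_mult} \<Rightarrow> 'a) \<Rightarrow> nat \<Rightarrow> ('a list \<Rightarrow> 'a) set set" where
  "HH scale n \<equiv> hoch_cohomology scale (regular_bimodule scale) n"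


section \<open>Hochschild homology\<close>

text \<open>
  \<open>M \<otimes> A\<^sup>\<otimes>\<^sup>n\<close> is the quotient of the space \<open>free_chains M n\<close> with basis \<open>M \<times> A\<^sup>n\<close> by the subspace
  \<open>tensor_relations scale M n\<close>; maps given on pure tensors are extended linearly from the basis.
  The tensor quotient and the homology quotient are taken in one step: a homology class is the
  set of all representatives in the free space of all chains in the class.
\<close>

type_synonym ('k, 'a, 'm) free_chain = "('m \<times> 'a list) \<Rightarrow>\<^sub>0 'k"

definition fscale :: "'k::field \<Rightarrow> ('t \<Rightarrow>\<^sub>0 'k) \<Rightarrow> ('t \<Rightarrow>\<^sub>0 'k)" where
  "fscale c x = Poly_Mapping.map ((*) c) x"

definition lin_ext :: "('t \<Rightarrow> ('u \<Rightarrow>\<^sub>0 'k::field)) \<Rightarrow> ('t \<Rightarrow>\<^sub>0 'k) \<Rightarrow> ('u \<Rightarrow>\<^sub>0 'k)" where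
  "lin_ext F x = (\<Sum>t\<in>Poly_Mapping.keys x. fscale (Poly_Mapping.lookup x t) (F t))"

definition free_chains ::
    "('k::field, 'a, 'm) bimodule \<Rightarrow> nat \<Rightarrow> ('k, 'a, 'm) free_chain set" where
  "free_chains M n =
     {x. \<forall>(m, as) \<in> Poly_Mapping.keys x. m \<in> carr M \<and> length as = n}"

definition tensor_relations ::
    "('k::field \<Rightarrow> 'a::{ring, monoid_mult} \<Rightarrow> 'a) \<Rightarrow> ('k, 'a, 'm::ab_group_add) bimodule \<Rightarrow> nat
      \<Rightarrow> ('k, 'a, 'm) free_chain set" where
  "tensor_relations scale M n = module.span fscale
     ({Poly_Mapping.single (m + m', as) 1 - Poly_Mapping.single (m, as) 1
         - Poly_Mapping.single (m', as) 1
        | m m' as. m \<in> carr M \<and> m' \<in> carr M \<and> length as = n} \<union>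
      {Poly_Mapping.single (scl M t m, as) 1 - Poly_Mapping.single (m, as) t
        | t m as. m \<in> carr M \<and> length as = n} \<union>
      {Poly_Mapping.single (m, as @ (a + a') # bs) 1 - Poly_Mapping.single (m, as @ a # bs) 1
         - Poly_Mapping.single (m, as @ a' # bs) 1
        | m as a a' bs. m \<in> carr M \<and> length as + length bs + 1 = n} \<union>
      {Poly_Mapping.single (m, as @ scale t a # bs) 1 - Poly_Mapping.single (m, as @ a # bs) t
        | t m as a bs. m \<in> carr M \<and> length as + length bs + 1 = n})"

definition hoch_boundary_pure ::
    "('k::field, 'a::{ring, monoid_mult}, 'm) bimodule \<Rightarrow> 'm \<times> 'a list
      \<Rightarrow> ('k, 'a, 'm) free_chain" where
  "hoch_boundary_pure M = (\<lambda>(m, as).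
     if as = [] then 0
     else Poly_Mapping.single (ract M m (hd as), tl as) 1
        + (\<Sum>i<length as - 1. Poly_Mapping.single (m, mult_at i as) ((-1) ^ Suc i))
        + Poly_Mapping.single (lact M (last as) m, butlast as) ((-1) ^ length as))"

definition cycles ::
    "('k::field \<Rightarrow> 'a::{ring, monoid_mult} \<Rightarrow> 'a) \<Rightarrow> ('k, 'a, 'm::ab_group_add) bimodule \<Rightarrow> nat
      \<Rightarrow> ('k, 'a, 'm) free_chain set" where
  "cycles scale M n =
     (case n of
        0 \<Rightarrow> free_chains M 0
      | Suc m \<Rightarrow> {x \<in> free_chains M n.
                  lin_ext (hoch_boundary_pure M) x \<in> tensor_relations scale M m})"

definition boundaries ::
    "('k::field \<Rightarrow> 'a::{ring, monoid_mult} \<Rightarrow> 'a) \<Rightarrow> ('k, 'a, 'm::ab_group_add) bimodule \<Rightarrow> nat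
      \<Rightarrow> ('k, 'a, 'm) free_chain set" where
  "boundaries scale M n =
     {r + lin_ext (hoch_boundary_pure M) y
       | r y. r \<in> tensor_relations scale M n \<and> y \<in> free_chains M (Suc n)}"

definition hoch_homology ::
    "('k::field \<Rightarrow> 'a::{ring, monoid_mult} \<Rightarrow> 'a) \<Rightarrow> ('k, 'a, 'm::ab_group_add) bimodule \<Rightarrow> nat
      \<Rightarrow> ('k, 'a, 'm) free_chain set set" where
  "hoch_homology scale M n = coset (boundaries scale M n) ` cycles scale M n"

text \<open>
  The \<open>k\<close>-dual of \<open>H\<^sub>n(A, M)\<close>. Functionals are \<open>extensional\<close> so that equality of
  functionals on \<open>H\<^sub>n(A, M)\<close> is equality in HOL.
\<close>

definition hoch_homology_dual ::
    "('k::field \<Rightarrow> 'a::{ring, monoid_mult} \<Rightarrow> 'a) \<Rightarrow> ('k, 'a, 'm::ab_group_add) bimodule \<Rightarrow> nat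
      \<Rightarrow> (('k, 'a, 'm) free_chain set \<Rightarrow> 'k) set" where
  "hoch_homology_dual scale M n =
     {\<phi> \<in> extensional (hoch_homology scale M n).
        (\<forall>x\<in>cycles scale M n. \<forall>y\<in>cycles scale M n.
           \<phi> (coset (boundaries scale M n) (x + y))
             = \<phi> (coset (boundaries scale M n) x) + \<phi> (coset (boundaries scale M n) y)) \<and>
        (\<forall>t. \<forall>x\<in>cycles scale M n.
           \<phi> (coset (boundaries scale M n) (fscale t x))
             = t * \<phi> (coset (boundaries scale M n) x))}"


section \<open>The operators\<close>

text \<open>
  \<open>twisted_rotation N i a\<^sub>0 [a\<^sub>1, \<dots>, a\<^sub>n]\<close> is
  \<open>a\<^sub>i \<otimes> \<dots> \<otimes> a\<^sub>n \<otimes> a\<^sub>0 \<otimes> N a\<^sub>1 \<otimes> \<dots> \<otimes> N a\<^sub>i\<^sub>-\<^sub>1\<close>. The index \<open>i\<close> is cyclic modulo \<open>n + 1\<close>: \<open>i = 0\<close> is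
  the full rotation \<open>i = n + 1\<close>, that is \<open>a\<^sub>0 \<otimes> N a\<^sub>1 \<otimes> \<dots> \<otimes> N a\<^sub>n\<close> (the two signs
  \<open>(-1)\<^sup>i\<^sup>n\<close> agree). With the untwisted \<open>a\<^sub>0 \<otimes> a\<^sub>1 \<otimes> \<dots> \<otimes> a\<^sub>n\<close> in place of it, the operators below
  would not preserve (co)cycles.
\<close>

definition twisted_rotation :: "('a \<Rightarrow> 'a) \<Rightarrow> nat \<Rightarrow> 'a \<Rightarrow> 'a list \<Rightarrow> 'a list" where
  "twisted_rotation N i a0 as =
     (if i = 0 then a0 # map N as
      else drop (i - 1) as @ a0 # map N (take (i - 1) as))"

text \<open>
  On all chains, \<open>b B + B b = T - 1\<close> for the diagonal action \<open>T\<close> of \<open>N\<close>, so \<open>B\<close> (and likewise the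
  other two operators) respects (co)cycles only on \<open>N\<close>-invariant (co)chains. When the order of \<open>N\<close>
  is finite and prime to the characteristic, each class has an invariant representative, and the
  operators on (co)homology are given by their formulas on these representatives.
\<close>

definition invariant_chains ::
    "('k::field \<Rightarrow> 'a::{ring, monoid_mult} \<Rightarrow> 'a) \<Rightarrow> ('a \<Rightarrow> 'a) \<Rightarrow> nat
      \<Rightarrow> ('k, 'a, 'a) free_chain set" where
  "invariant_chains scale N n =
     {x \<in> free_chains (twisted_bimodule scale N) n.
        lin_ext (\<lambda>(a0, as). Poly_Mapping.single (N a0, map N as) 1) x - x
          \<in> tensor_relations scale (twisted_bimodule scale N) n}"

definition connes_pure ::
    "('a::{ring, monoid_mult} \<Rightarrow> 'a) \<Rightarrow> 'a \<times> 'a list \<Rightarrow> ('k::field, 'a, 'a) free_chain" where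
  "connes_pure N = (\<lambda>(a0, as).
     \<Sum>i\<le>length as.
       Poly_Mapping.single (1, twisted_rotation N i a0 as) ((-1) ^ (i * length as)))"

definition B_nak ::
    "('k::field \<Rightarrow> 'a::{ring, monoid_mult} \<Rightarrow> 'a) \<Rightarrow> ('a \<Rightarrow> 'a) \<Rightarrow> nat
      \<Rightarrow> ('k, 'a, 'a) free_chain set \<Rightarrow> ('k, 'a, 'a) free_chain set" where
  "B_nak scale N n =
     induced_map (lin_ext (connes_pure N)) (invariant_chains scale N n)
       (hoch_homology scale (twisted_bimodule scale N) (Suc n))"

text \<open>\<open>B_nak_dual scale N n\<close> maps \<open>H\<^sub>n\<^sub>+\<^sub>1(A, A\<^sub>N)\<^sup>*\<close> to \<open>H\<^sub>n(A, A\<^sub>N)\<^sup>*\<close>.\<close>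

definition B_nak_dual ::
    "('k::field \<Rightarrow> 'a::{ring, monoid_mult} \<Rightarrow> 'a) \<Rightarrow> ('a \<Rightarrow> 'a) \<Rightarrow> nat
      \<Rightarrow> (('k, 'a, 'a) free_chain set \<Rightarrow> 'k) \<Rightarrow> (('k, 'a, 'a) free_chain set \<Rightarrow> 'k)" where
  "B_nak_dual scale N n =
     (\<lambda>\<phi>\<in>hoch_homology_dual scale (twisted_bimodule scale N) (Suc n).
        \<lambda>h\<in>hoch_homology scale (twisted_bimodule scale N) n. \<phi> (B_nak scale N n h))"

text \<open>
  The isomorphism \<open>\<partial>\<^sup>-\<^sup>1\<close>, \<open>[f] \<mapsto> ([a\<^sub>0 \<otimes> \<dots> \<otimes> a\<^sub>n] \<mapsto> \<langle>f (a\<^sub>1 \<otimes> \<dots> \<otimes> a\<^sub>n), a\<^sub>0\<rangle>)\<close>, is the isomorphism \<open>Z\<^sub>*\<close>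
  followed by the adjunction \<open>H\<^sup>n(A, A\<^sub>N\<^sup>*) \<cong> H\<^sub>n(A, A\<^sub>N)\<^sup>*\<close>. Two points differ from the formula
  \<open>(-1)\<^sup>n \<langle>a\<^sub>0, f (a\<^sub>1 \<otimes> \<dots> \<otimes> a\<^sub>n)\<rangle>\<close> found in the literature. (1) For the form and the
  bimodule \<open>A\<^sub>N\<close> used here, it is \<open>\<langle>f (\<dots>), a\<^sub>0\<rangle>\<close> that vanishes on boundaries for each cocycle
  \<open>f\<close>; \<open>\<langle>a\<^sub>0, f (\<dots>)\<rangle>\<close> does so only under extra conditions such as \<open>N = id\<close>. (2) The sign \<open>(-1)\<^sup>n\<close>
  would turn \<open>\<partial> B\<^sup>* \<partial>\<^sup>-\<^sup>1\<close> into its negative, as it occurs once in degree \<open>n\<close> and once in degree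
  \<open>n - 1\<close>: for \<open>A = k[x]/(x\<^sup>2)\<close>, \<open>\<langle>a, b\<rangle>\<close> the coefficient of \<open>x\<close> in \<open>a b\<close>, and the derivation
  \<open>f\<close> with \<open>f x = x\<close>, one has \<open>\<Delta> f = 1\<close>, and the signed version would give \<open>-1\<close>.
\<close>

definition pairing ::
    "('a \<Rightarrow> 'a \<Rightarrow> 'k::field) \<Rightarrow> ('a list \<Rightarrow> 'a) \<Rightarrow> ('k, 'a, 'a) free_chain \<Rightarrow> 'k" where
  "pairing form f x =
     (\<Sum>(a0, as)\<in>Poly_Mapping.keys x. Poly_Mapping.lookup x (a0, as) * form (f as) a0)"

definition del_inv ::
    "('k::field \<Rightarrow> 'a::{ring, monoid_mult} \<Rightarrow> 'a) \<Rightarrow> ('a \<Rightarrow> 'a \<Rightarrow> 'k) \<Rightarrow> ('a \<Rightarrow> 'a) \<Rightarrow> nat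
      \<Rightarrow> ('a list \<Rightarrow> 'a) set \<Rightarrow> (('k, 'a, 'a) free_chain set \<Rightarrow> 'k)" where
  "del_inv scale form N n c =
     (\<lambda>h\<in>hoch_homology scale (twisted_bimodule scale N) n.
        THE v. \<forall>f\<in>c. \<forall>x\<in>h. pairing form f x = v)"

definition del ::
    "('k::field \<Rightarrow> 'a::{ring, monoid_mult} \<Rightarrow> 'a) \<Rightarrow> ('a \<Rightarrow> 'a \<Rightarrow> 'k) \<Rightarrow> ('a \<Rightarrow> 'a) \<Rightarrow> nat
      \<Rightarrow> (('k, 'a, 'a) free_chain set \<Rightarrow> 'k) \<Rightarrow> ('a list \<Rightarrow> 'a) set" where
  "del scale form N n =
     (\<lambda>\<phi>\<in>hoch_homology_dual scale (twisted_bimodule scale N) n.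
        inv_into (HH scale n) (del_inv scale form N n) \<phi>)"

definition Z_star ::
    "('k::field \<Rightarrow> 'a::{ring, monoid_mult} \<Rightarrow> 'a) \<Rightarrow> ('a \<Rightarrow> 'a \<Rightarrow> 'k) \<Rightarrow> ('a \<Rightarrow> 'a) \<Rightarrow> nat
      \<Rightarrow> ('a list \<Rightarrow> 'a) set \<Rightarrow> ('a list \<Rightarrow> 'a \<Rightarrow> 'k) set" where
  "Z_star scale form N n =
     induced_map (\<lambda>f as. form (f as)) UNIV
       (hoch_cohomology scale (twisted_dual_bimodule scale N) n)"

definition Z_star_inv ::
    "('k::field \<Rightarrow> 'a::{ring, monoid_mult} \<Rightarrow> 'a) \<Rightarrow> ('a \<Rightarrow> 'a \<Rightarrow> 'k) \<Rightarrow> ('a \<Rightarrow> 'a) \<Rightarrow> nat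
      \<Rightarrow> ('a list \<Rightarrow> 'a \<Rightarrow> 'k) set \<Rightarrow> ('a list \<Rightarrow> 'a) set" where
  "Z_star_inv scale form N n = inv_into (HH scale n) (Z_star scale form N n)"

definition B_bar_cochain ::
    "('a::{ring, monoid_mult} \<Rightarrow> 'a) \<Rightarrow> ('a list \<Rightarrow> 'a \<Rightarrow> 'k::field) \<Rightarrow> ('a list \<Rightarrow> 'a \<Rightarrow> 'k)" where
  "B_bar_cochain N f as a0 =
     (\<Sum>i\<le>length as. (-1) ^ (i * length as) * f (twisted_rotation N i a0 as) 1)"

text \<open>\<open>B_bar scale N n\<close> maps \<open>H\<^sup>n\<^sup>+\<^sup>1(A, A\<^sub>N\<^sup>*)\<close> to \<open>H\<^sup>n(A, A\<^sub>N\<^sup>*)\<close>; \<open>N\<close> acts on \<open>A\<^sub>N\<^sup>*\<close> by \<open>\<phi> \<mapsto> \<phi> \<circ> N\<^sup>-\<^sup>1\<close>.\<close>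

definition B_bar ::
    "('k::field \<Rightarrow> 'a::{ring, monoid_mult} \<Rightarrow> 'a) \<Rightarrow> ('a \<Rightarrow> 'a) \<Rightarrow> nat
      \<Rightarrow> ('a list \<Rightarrow> 'a \<Rightarrow> 'k) set \<Rightarrow> ('a list \<Rightarrow> 'a \<Rightarrow> 'k) set" where
  "B_bar scale N n =
     induced_map (B_bar_cochain N) {f. \<forall>as a0. f (map N as) (N a0) = f as a0}
       (hoch_cohomology scale (twisted_dual_bimodule scale N) n)"

definition volkov_cochain ::
    "('a::{ring, monoid_mult} \<Rightarrow> 'a \<Rightarrow> 'k::field) \<Rightarrow> ('a \<Rightarrow> 'a) \<Rightarrow> ('a list \<Rightarrow> 'a) \<Rightarrow> ('a list \<Rightarrow> 'a)" where
  "volkov_cochain form N f as =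
     (THE v. \<forall>a0. form v a0 =
        (\<Sum>i\<le>length as. (-1) ^ (i * length as) * form (f (twisted_rotation N i a0 as)) 1))"

text \<open>\<open>volkov_delta scale form N n\<close> maps \<open>HH\<^sup>n\<^sup>+\<^sup>1(A)\<close> to \<open>HH\<^sup>n(A)\<close>.\<close>

definition volkov_delta ::
    "('k::field \<Rightarrow> 'a::{ring, monoid_mult} \<Rightarrow> 'a) \<Rightarrow> ('a \<Rightarrow> 'a \<Rightarrow> 'k) \<Rightarrow> ('a \<Rightarrow> 'a) \<Rightarrow> nat
      \<Rightarrow> ('a list \<Rightarrow> 'a) set \<Rightarrow> ('a list \<Rightarrow> 'a) set" where
  "volkov_delta scale form N n =
     induced_map (volkov_cochain form N) {f. \<forall>as. f (map N as) = N (f as)} (HH scale n)"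

end

theory Submission
  imports Defs
begin

text \<open>
  Write \<open>M = A\<^sub>N\<close>, \<open>b\<close> for the Hochschild boundary, \<open>B\<close> for the Connes-type map and \<open>T\<close> for the
  diagonal action of \<open>N\<close> on chains. All three operators of the theorem are the same operator seen
  through the pairing \<open>\<langle>f (a\<^sub>1 \<otimes> \<dots> \<otimes> a\<^sub>n), a\<^sub>0\<rangle>\<close> of a cochain \<open>f : A\<^sup>\<otimes>\<^sup>n \<rightarrow> A\<close> with a chain
  \<open>a\<^sub>0 \<otimes> \<dots> \<otimes> a\<^sub>n\<close> of \<open>M\<close>. By non-degeneracy and finite dimension, cochains are exactly the linear
  functionals on the free chains that kill the tensor relations (\<open>cochain_of_functional\<close>). Under this
  identification the coboundary is the transpose of \<open>b\<close> (\<open>pairing_coboundary\<close>), Volkov's formula is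
  the transpose of \<open>B\<close> (\<open>pairing_volkov_cochain\<close>), and \<open>Z\<close> merely turns values in \<open>A\<close> into values in
  the dual of \<open>A\<close>, which carries Volkov's formula to the formula for the operator on
  \<open>H\<^sup>n(A, A\<^sub>N\<^sup>*)\<close>. So on representatives nothing remains to be compared; the work is to show that
  the operators are well defined on classes, so that their values are the classes of these
  representatives.

  That rests on the identity \<open>b B + B b = T - 1\<close> (\<open>connes_homotopy\<close>), which together with \<open>b b = 0\<close>
  makes \<open>b\<close> and \<open>T\<close> commute. As the order \<open>m\<close> of \<open>N\<close> is invertible in \<open>k\<close>, the average
  \<open>(1 + T + \<dots> + T\<^sup>m\<^sup>-\<^sup>1) / m\<close> exists; it projects onto invariant chains, and since it differs from \<open>1\<close>
  by a multiple of \<open>T - 1\<close>, it is chain homotopic to the identity (\<open>average_homotopy\<close>). Hence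
  each homology class and, by transposition, each cohomology class has an invariant representative.
  On invariant chains \<open>B\<close> anticommutes with \<open>b\<close> up to tensor relations, so it preserves cycles, and,
  after averaging a bounding chain, boundaries (\<open>connes_cyc\<close>, \<open>connes_bdr\<close>); the statements for
  cochains follow by transposition (\<open>volkov_cocycle\<close>, \<open>volkov_coboundary\<close>).

  To invert \<open>\<partial>\<^sup>-\<^sup>1\<close> one needs its injectivity. A functional that vanishes on cycles factors through
  \<open>b\<close>, by linear algebra over a field, and therefore a cochain is a coboundary if and only if it pairs
  to zero with all cycles (\<open>coboundary_iff\<close>).
\<close>

section \<open>Linear maps on free vector spaces\<close>

lemma lookup_fscale [simp]: "Poly_Mapping.lookup (fscale c x) t = c * Poly_Mapping.lookup x t"
  by (simp add: fscale_def Poly_Mapping.map.rep_eq when_def)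

interpretation free_space: vector_space "fscale :: 'k::field \<Rightarrow> ('t \<Rightarrow>\<^sub>0 'k) \<Rightarrow> ('t \<Rightarrow>\<^sub>0 'k)"
  by unfold_locales
    (auto intro!: poly_mapping_eqI simp: lookup_add algebra_simps)

interpretation field_space: vector_space "(*) :: 'k::field \<Rightarrow> 'k \<Rightarrow> 'k"
  by unfold_locales (auto simp: algebra_simps)

lemma fscale_single [simp]: "fscale c (Poly_Mapping.single t d) = Poly_Mapping.single t (c * d)"
  by (rule poly_mapping_eqI) (simp add: lookup_single when_def)

text \<open>
  The target is arbitrary, so that chain maps (\<open>lin_ext\<close>) and functionals (\<open>pairing\<close>) are both instances.
\<close>

definition extend_linearly ::
    "('k::field \<Rightarrow> 'v \<Rightarrow> 'v::ab_group_add) \<Rightarrow> ('t \<Rightarrow> 'v) \<Rightarrow> ('t \<Rightarrow>\<^sub>0 'k) \<Rightarrow> 'v" where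
  "extend_linearly s F x = (\<Sum>t\<in>Poly_Mapping.keys x. s (Poly_Mapping.lookup x t) (F t))"

lemma lin_ext_eq: "lin_ext F = extend_linearly fscale F"
  by (simp add: fun_eq_iff lin_ext_def extend_linearly_def)

lemma pairing_eq: "pairing form f = extend_linearly (*) (\<lambda>(a0, as). form (f as) a0)"
  by (simp add: fun_eq_iff pairing_def extend_linearly_def case_prod_unfold)

context vector_space
begin

lemma extend_linearly_superset:
  assumes "finite S" "Poly_Mapping.keys x \<subseteq> S"
  shows "extend_linearly scale F x = (\<Sum>t\<in>S. scale (Poly_Mapping.lookup x t) (F t))"
  unfolding extend_linearly_def
  using assms by (intro sum.mono_neutral_left) (auto simp: in_keys_iff)

lemma extend_linearly_single [simp]:
  "extend_linearly scale F (Poly_Mapping.single t c) = scale c (F t)"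
  by (subst extend_linearly_superset[of "{t}"]) auto

lemma linear_extend_linearly: "Vector_Spaces.linear fscale scale (extend_linearly scale F)"
proof -
  have "extend_linearly scale F (x + y) = extend_linearly scale F x + extend_linearly scale F y" for x y
  proof -
    let ?S = "Poly_Mapping.keys x \<union> Poly_Mapping.keys y"
    have "Poly_Mapping.keys (x + y) \<subseteq> ?S" by (rule keys_add)
    then show ?thesis
      by (simp add: extend_linearly_superset[of ?S] lookup_add scale_left_distrib sum.distrib)
  qed
  moreover have "extend_linearly scale F (fscale c x) = scale c (extend_linearly scale F x)" for c x
  proof -
    have "Poly_Mapping.keys (fscale c x) \<subseteq> Poly_Mapping.keys x" by (auto simp: in_keys_iff)
    then show ?thesis
      by (simp add: extend_linearly_superset[of "Poly_Mapping.keys x"] scale_sum_right)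
  qed
  ultimately show ?thesis
    by (simp add: Vector_Spaces.linear_iff free_space.vector_space_axioms vector_space_axioms)
qed

end

lemma sum_singles: "(\<Sum>t\<in>Poly_Mapping.keys x. Poly_Mapping.single t (Poly_Mapping.lookup x t)) = x"
  by (rule poly_mapping_eqI)
    (simp add: lookup_sum lookup_single when_def sum.delta' in_keys_iff)

lemma linear_map_zero: "Vector_Spaces.linear s1 s2 f \<Longrightarrow> f 0 = 0"
  and linear_map_add: "Vector_Spaces.linear s1 s2 f \<Longrightarrow> f (x + y) = f x + f y"
  and linear_map_diff: "Vector_Spaces.linear s1 s2 f \<Longrightarrow> f (x - y) = f x - f y"
  and linear_map_neg: "Vector_Spaces.linear s1 s2 f \<Longrightarrow> f (- x) = - f x"
  and linear_map_scale: "Vector_Spaces.linear s1 s2 f \<Longrightarrow> f (s1 c x) = s2 c (f x)"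
  by (simp_all add: linear_iff_module_hom module_hom.zero module_hom.add module_hom.diff
      module_hom.neg module_hom.scale)

lemma linear_map_sum: "Vector_Spaces.linear s1 s2 f \<Longrightarrow> f (sum g S) = (\<Sum>i\<in>S. f (g i))"
  by (simp add: linear_iff_module_hom module_hom.sum)

lemma linear_map_compose: 
  "Vector_Spaces.linear s1 s2 f \<Longrightarrow> Vector_Spaces.linear s2 s3 g \<Longrightarrow> Vector_Spaces.linear s1 s3 (\<lambda>x. g (f x))"
  by (simp add: Vector_Spaces.linear_iff)

lemma linear_map_pointwise_add: "Vector_Spaces.linear s1 s2 f \<Longrightarrow> Vector_Spaces.linear s1 s2 g \<Longrightarrow> Vector_Spaces.linear s1 s2 (\<lambda>x. f x + g x)"
  and linear_map_pointwise_diff: "Vector_Spaces.linear s1 s2 f \<Longrightarrow> Vector_Spaces.linear s1 s2 g \<Longrightarrow> Vector_Spaces.linear s1 s2 (\<lambda>x. f x - g x)"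
  by (simp_all add: linear_iff_module_hom module_hom_iff module.scale_right_distrib
      module.scale_right_diff_distrib module.scale_minus_right)

lemma linear_const_0: "Vector_Spaces.linear fscale fscale (\<lambda>_. 0)"
  by (simp add: Vector_Spaces.linear_iff free_space.vector_space_axioms)

lemma linear_self: "Vector_Spaces.linear fscale fscale (\<lambda>x. x)"
  by (simp add: Vector_Spaces.linear_iff free_space.vector_space_axioms)

text \<open>
  The free chains of degree \<open>n\<close> do not form a type; agreement on the basis vectors that occur in \<open>x\<close>
  is enough for agreement at \<open>x\<close>, which makes identities on basis vectors of one degree usable.
\<close>

lemma linear_eq_on_keys:
  assumes f: "Vector_Spaces.linear fscale s f" and g: "Vector_Spaces.linear fscale s g"
    and eq: "\<And>t. t \<in> Poly_Mapping.keys x \<Longrightarrow>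
      f (Poly_Mapping.single t 1) = g (Poly_Mapping.single t 1)"
  shows "f x = g x"
proof -
  have "h x = (\<Sum>t\<in>Poly_Mapping.keys x. s (Poly_Mapping.lookup x t) (h (Poly_Mapping.single t 1)))"
    if "Vector_Spaces.linear fscale s h" for h
    by (subst (1) sum_singles[of x, symmetric], subst linear_map_sum[OF that])
      (simp flip: linear_map_scale[OF that])
  from this[OF f] this[OF g] show ?thesis
    using eq by simp
qed

lemma linear_lin_ext [simp]: "Vector_Spaces.linear fscale fscale (lin_ext F)"
  unfolding lin_ext_eq by (rule free_space.linear_extend_linearly)

lemma lin_ext_single [simp]: "lin_ext F (Poly_Mapping.single t c) = fscale c (F t)"
  unfolding lin_ext_eq by (rule free_space.extend_linearly_single)

lemma linear_pairing [simp]: "Vector_Spaces.linear fscale (*) (pairing form f)"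
  unfolding pairing_eq by (rule field_space.linear_extend_linearly)

lemma pairing_single [simp]:
  "pairing form f (Poly_Mapping.single (a0, as) c) = c * form (f as) a0"
  unfolding pairing_eq by simp

text \<open>
  The linear algebra behind the injectivity of \<open>\<partial>\<^sup>-\<^sup>1\<close>: with \<open>L\<close> the boundary map, \<open>W\<close> the chains of one
  degree and \<open>R\<close> the tensor relations one degree lower, \<open>{x \<in> W. L x \<in> R}\<close> is the space of cycles, and
  \<open>P\<close> descends to a functional on the boundaries, which extends to all chains.
\<close>

lemma factor_functional:
  fixes L :: "('t \<Rightarrow>\<^sub>0 'k::field) \<Rightarrow> ('u \<Rightarrow>\<^sub>0 'k)"
  assumes L: "Vector_Spaces.linear fscale fscale L" and P: "Vector_Spaces.linear fscale (*) P"
    and W: "free_space.subspace W" and R: "free_space.subspace R"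
    and vanish: "\<And>x. x \<in> W \<Longrightarrow> L x \<in> R \<Longrightarrow> P x = 0"
  obtains \<psi> where "Vector_Spaces.linear fscale (*) \<psi>" "\<And>r. r \<in> R \<Longrightarrow> \<psi> r = 0"
    "\<And>x. x \<in> W \<Longrightarrow> \<psi> (L x) = P x"
proof -
  interpret uu: vector_space_pair "fscale :: 'k \<Rightarrow> ('u \<Rightarrow>\<^sub>0 'k) \<Rightarrow> _" "fscale :: 'k \<Rightarrow> ('u \<Rightarrow>\<^sub>0 'k) \<Rightarrow> _"
    by unfold_locales
  interpret tu: vector_space_pair "fscale :: 'k \<Rightarrow> ('t \<Rightarrow>\<^sub>0 'k) \<Rightarrow> _" "fscale :: 'k \<Rightarrow> ('u \<Rightarrow>\<^sub>0 'k) \<Rightarrow> _"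
    by unfold_locales
  have "\<exists>g. g ` UNIV \<subseteq> R \<and> Vector_Spaces.linear fscale fscale g \<and> (\<forall>v\<in>R. g v = v)"
    using uu.linear_exists_left_inverse_on[OF free_space.linear_ident R] by simp
  then obtain \<rho> where \<rho>: "\<And>u. \<rho> u \<in> R" "Vector_Spaces.linear fscale fscale \<rho>" "\<And>v. v \<in> R \<Longrightarrow> \<rho> v = v"
    by auto
  \<comment> \<open>As \<open>\<rho>\<close> is a projection onto \<open>R\<close>, the kernel of \<open>\<pi>\<close> is \<open>R\<close>; so \<open>\<pi>\<close> stands in for the quotient by \<open>R\<close>.\<close>
  define \<pi> where "\<pi> u = u - \<rho> u" for u
  have \<pi>: "Vector_Spaces.linear fscale fscale \<pi>"
    unfolding \<pi>_def using \<rho>(2) free_space.linear_ident uu.linear_compose_sub by blast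
  have \<pi>R: "\<pi> u = 0 \<longleftrightarrow> u \<in> R" for u
    using \<rho>(1)[of u] \<rho>(3)[of u] by (auto simp: \<pi>_def)
  have \<pi>L: "Vector_Spaces.linear fscale fscale (\<lambda>x. \<pi> (L x))"
    by (rule linear_map_compose[OF L \<pi>])
  obtain g where g: "\<And>u. g u \<in> W" "Vector_Spaces.linear fscale fscale g"
      "\<And>x. x \<in> W \<Longrightarrow> \<pi> (L (g (\<pi> (L x)))) = \<pi> (L x)"
    using tu.linear_exists_right_inverse_on[OF \<pi>L W] by auto
  show thesis
  proof
    show "Vector_Spaces.linear fscale (*) (\<lambda>u. P (g (\<pi> u)))"
      by (intro linear_map_compose[OF \<pi>] linear_map_compose[OF g(2)] P)
    show "P (g (\<pi> r)) = 0" if "r \<in> R" for r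
      using that \<pi>R[of r] by (simp add: linear_map_zero[OF g(2)] linear_map_zero[OF P])
    show "P (g (\<pi> (L x))) = P x" if "x \<in> W" for x
    proof -
      let ?y = "g (\<pi> (L x)) - x"
      have "?y \<in> W" using g(1) that W by (simp add: free_space.subspace_diff)
      moreover have "\<pi> (L ?y) = 0"
        using g(3)[OF that] by (simp add: linear_map_diff[OF \<pi>L])
      ultimately have "P ?y = 0" using vanish \<pi>R by blast
      then show ?thesis by (simp add: linear_map_diff[OF P])
    qed
  qed
qed

section \<open>Twisted rotations and products of neighbouring letters\<close>

text \<open>
  The pure tensor \<open>a\<^sub>0 \<otimes> a\<^sub>1 \<otimes> \<dots> \<otimes> a\<^sub>n\<close> is treated as the word \<open>a\<^sub>1 \<dots> a\<^sub>n a\<^sub>0\<close>, with the coefficient at the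
  end. Then all faces of the boundary but one are products of neighbouring letters, the remaining
  one is such a product after a twisted rotation, and the summands of the Connes map are
  the iterated rotations of the word. The chain identities thus reduce to commutation rules between
  \<open>rot N\<close> and \<open>mult_at i\<close>.
\<close>

definition rot :: "('a \<Rightarrow> 'a) \<Rightarrow> 'a list \<Rightarrow> 'a list" where
  "rot N w = tl w @ [N (hd w)]"

lemma length_rot [simp]: "w \<noteq> [] \<Longrightarrow> length (rot N w) = length w"
  by (cases w) (auto simp: rot_def)

lemma rot_Cons [simp]: "rot N (x # w) = w @ [N x]"
  by (simp add: rot_def)

lemma length_rot_pow [simp]: "w \<noteq> [] \<Longrightarrow> length ((rot N ^^ l) w) = length w"
proof (induction l)
  case (Suc l)
  then have "(rot N ^^ l) w \<noteq> []" by (metis length_0_conv)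
  with Suc show ?case by simp
qed simp

lemma rot_pow: "l \<le> length w \<Longrightarrow> (rot N ^^ l) w = drop l w @ map N (take l w)"
proof (induction l)
  case (Suc l)
  then have "drop l w = w ! l # drop (Suc l) w" by (simp add: Cons_nth_drop_Suc)
  with Suc show ?case by (simp add: take_Suc_conv_app_nth)
qed simp

lemma length_mult_at [simp]: "Suc i < length w \<Longrightarrow> length (mult_at i w) = length w - 1"
  by (simp add: mult_at_def)

lemma nth_mult_at:
  "Suc i < length w \<Longrightarrow> j < length w - 1 \<Longrightarrow>
    mult_at i w ! j = (if j < i then w ! j else if j = i then w ! i * w ! Suc i else w ! Suc j)"
  by (auto simp: mult_at_def nth_append nth_Cons')

lemma mult_at_Suc_Cons [simp]: "mult_at (Suc i) (x # w) = x # mult_at i w"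
  by (simp add: mult_at_def)

lemma mult_at_0 [simp]: "mult_at 0 (x # y # w) = (x * y) # w"
  by (simp add: mult_at_def)

lemma mult_at_append: "Suc i < length v \<Longrightarrow> mult_at i (v @ w) = mult_at i v @ w"
  by (simp add: mult_at_def nth_append)

lemma mult_at_append_pair: "length v = i \<Longrightarrow> mult_at i (v @ x # y # w) = v @ (x * y) # w"
  by (simp add: mult_at_def nth_append)

text \<open>
  The simplicial identity of the bar construction: disjoint products commute, and for \<open>i = j\<close> the rule
  is associativity.
\<close>

lemma mult_at_mult_at:
  fixes w :: "'a::semigroup_mult list"
  shows "i \<le> j \<Longrightarrow> Suc (Suc j) < length w \<Longrightarrow> mult_at i (mult_at (Suc j) w) = mult_at j (mult_at i w)"
proof (induction i arbitrary: j w)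
  case 0
  then obtain x y z r where w: "w = x # y # z # r"
    by (auto simp: Suc_le_eq Suc_less_eq2 length_Suc_conv dest!: less_imp_Suc_add)
  show ?case
    by (cases j) (simp_all add: w mult.assoc)
next
  case (Suc i)
  then obtain j' x r where "j = Suc j'" "w = x # r"
    by (cases j; cases w) auto
  with Suc show ?case by simp
qed

lemma rot_mult_at_Suc:
  "Suc (Suc i) < length w \<Longrightarrow> rot N (mult_at (Suc i) w) = mult_at i (rot N w)"
  by (cases w) (simp_all add: mult_at_append)

text \<open>
  The product of the first two letters travels to the end as one letter, whereas the single letters need
  two rotations; this is where multiplicativity of \<open>N\<close> enters.
\<close>

lemma rot_mult_at_0:
  assumes "length w = Suc (Suc m)" "N (w ! 0 * w ! 1) = N (w ! 0) * N (w ! 1)"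
  shows "rot N (mult_at 0 w) = mult_at m (rot N (rot N w))"
proof -
  obtain x y r where "w = x # y # r" "length r = m"
    using assms by (auto simp: length_Suc_conv)
  with assms show ?thesis by (simp add: mult_at_append_pair)
qed

text \<open>
  Each rotation moves the product one place to the left until it wraps around; from then on one extra
  rotation of \<open>w\<close> is needed.
\<close>

lemma rot_pow_mult_at:
  assumes "length w = Suc n" "k < n" "\<And>a b. N (a * b) = N a * N b"
  shows "l \<le> n + k \<Longrightarrow> (rot N ^^ l) (mult_at k w) =
    (if l \<le> k then mult_at (k - l) ((rot N ^^ l) w) else mult_at (n + k - l) ((rot N ^^ Suc l) w))"
proof (induction l)
  case (Suc l)
  let ?v = "(rot N ^^ l) w"
  have w: "w \<noteq> []" using assms(1) by auto
  then have v: "length ?v = Suc n" using assms(1) by simp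
  then have "?v \<noteq> []" by auto
  then have [simp]: "length ?v = Suc n" "length (rot N ?v) = Suc n"
    using v by simp_all
  consider "Suc l \<le> k" | "l = k" | "k < l" by linarith
  then show ?case
  proof cases
    case 1
    then have "(rot N ^^ Suc l) (mult_at k w) = rot N (mult_at (Suc (k - Suc l)) ?v)"
      using Suc by (simp add: Suc_diff_Suc)
    also have "\<dots> = mult_at (k - Suc l) (rot N ?v)"
      using 1 assms(2) by (intro rot_mult_at_Suc) simp
    finally show ?thesis using 1 by simp
  next
    case 2
    then have "(rot N ^^ Suc l) (mult_at k w) = rot N (mult_at 0 ?v)"
      using Suc by simp
    also have "\<dots> = mult_at (n - 1) (rot N (rot N ?v))"
      using assms by (intro rot_mult_at_0) simp_all
    finally show ?thesis using 2 by simp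
  next
    case 3
    then have "(rot N ^^ Suc l) (mult_at k w) = rot N (mult_at (Suc (n + k - Suc l)) (rot N ?v))"
      using Suc by (simp add: Suc_diff_Suc)
    also have "\<dots> = mult_at (n + k - Suc l) (rot N (rot N ?v))"
    proof (rule rot_mult_at_Suc)
      show "Suc (Suc (n + k - Suc l)) < length (rot N ?v)" using 3 Suc.prems by simp
    qed
    finally show ?thesis using 3 by simp
  qed
qed simp

definition tensor :: "'a list \<Rightarrow> 'a \<times> 'a list" where
  "tensor w = (last w, butlast w)"

lemma tensor_snoc [simp]: "tensor (as @ [a]) = (a, as)"
  by (simp add: tensor_def)

text \<open>
  Face \<open>0\<close> is \<open>a\<^sub>0 N(a\<^sub>1) \<otimes> a\<^sub>2 \<otimes> \<dots>\<close>, the right action of \<open>A\<^sub>N\<close>: rotating the word puts \<open>N(a\<^sub>1)\<close> behind \<open>a\<^sub>0\<close>.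
  The last face \<open>a\<^sub>n a\<^sub>0 \<otimes> a\<^sub>1 \<otimes> \<dots>\<close> is the product of the last two letters.
\<close>

definition face :: "('a::times \<Rightarrow> 'a) \<Rightarrow> nat \<Rightarrow> 'a list \<Rightarrow> 'a list" where
  "face N k w = (case k of 0 \<Rightarrow> mult_at (length w - 2) (rot N w) | Suc i \<Rightarrow> mult_at i w)"

lemma length_face: "length w = Suc (Suc m) \<Longrightarrow> k \<le> Suc m \<Longrightarrow> length (face N k w) = Suc m"
  by (cases w; cases k) (auto simp: face_def)

lemma sum_atMost_Suc_ends:
  fixes F :: "nat \<Rightarrow> 'v::comm_monoid_add"
  shows "(\<Sum>k\<le>Suc m. F k) = F 0 + ((\<Sum>i<m. F (Suc i)) + F (Suc m))"
  by (subst sum.atMost_Suc_shift) (simp add: lessThan_Suc_atMost[symmetric])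

lemma boundary_tensor:
  fixes N :: "'a::{ring, monoid_mult} \<Rightarrow> 'a" and scale :: "'k::field \<Rightarrow> 'a \<Rightarrow> 'a"
  assumes "length w = Suc (Suc m)"
  shows "hoch_boundary_pure (twisted_bimodule scale N) (tensor w) =
    (\<Sum>k\<le>Suc m. Poly_Mapping.single (tensor (face N k w)) ((-1) ^ k))"
proof -
  obtain a as a0 where w: "w = a # as @ [a0]" and as: "length as = m"
    using assms by (metis length_Suc_conv length_append_singleton rev_exhaust length_0_conv nat.distinct(1) Suc_inject)
  have t: "tensor w = (a0, a # as)"
    by (simp add: w tensor_def)
  have f0: "tensor (face N 0 w) = (a0 * N a, as)"
    using mult_at_append_pair[of as m a0 "N a" "[]"] by (simp add: w face_def as tensor_def)
  have fi: "tensor (face N (Suc i) w) = (a0, mult_at i (a # as))" if "i < m" for i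
    using mult_at_append[of i "a # as" "[a0]"] that as by (simp add: w face_def)
  have fm: "tensor (face N (Suc m) w) = (last (a # as) * a0, butlast (a # as))"
  proof -
    obtain v x where v: "a # as = v @ [x]" by (metis rev_exhaust list.distinct(1))
    then have "w = v @ [x, a0]" using w by simp
    moreover have "length v = m"
    proof -
      have "length (a # as) = length (v @ [x])" by (simp only: v)
      then show ?thesis by (simp add: as)
    qed
    ultimately show ?thesis
      using mult_at_append_pair[of v m x a0 "[]"] v by (simp add: face_def tensor_def)
  qed
  have "(\<Sum>k\<le>Suc m. Poly_Mapping.single (tensor (face N k w)) ((-1) ^ k)) =
     Poly_Mapping.single (a0 * N a, as) 1
     + ((\<Sum>i<m. Poly_Mapping.single (a0, mult_at i (a # as)) ((-1) ^ Suc i))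
        + Poly_Mapping.single (last (a # as) * a0, butlast (a # as)) ((-1 :: 'k) ^ Suc m))"
    unfolding sum_atMost_Suc_ends by (simp only: f0 fm power_0) (simp add: fi)
  then show ?thesis
    unfolding t by (simp add: hoch_boundary_pure_def twisted_bimodule_def as add.assoc)
qed

text \<open>
  The index \<open>l\<close> counts rotations of \<open>a\<^sub>1 \<dots> a\<^sub>n a\<^sub>0\<close>, hence is one less than that of \<open>twisted_rotation\<close>; the full
  rotation \<open>i = 0\<close> becomes \<open>l = n\<close>, with the same sign because \<open>(n + 1) n\<close> is even.
\<close>

lemma connes_tensor:
  fixes N :: "'a::{ring, monoid_mult} \<Rightarrow> 'a"
  assumes "length w = Suc n"
  shows "(connes_pure N (tensor w) :: ('k::field, 'a, 'a) free_chain) =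
    (\<Sum>l\<le>n. Poly_Mapping.single (tensor ((rot N ^^ l) w @ [1])) ((-1) ^ (Suc l * n)))"
proof -
  obtain as a0 where w: "w = as @ [a0]" and as: "length as = n"
    using assms by (metis length_append_singleton rev_exhaust length_0_conv nat.distinct(1) Suc_inject)
  have r: "twisted_rotation N (Suc l) a0 as = (rot N ^^ l) w" if "l \<le> n" for l
    using that by (simp add: twisted_rotation_def rot_pow w as)
  have r0: "twisted_rotation N 0 a0 as = (rot N ^^ n) w"
    by (simp add: twisted_rotation_def rot_pow w as)
  have "even (Suc n * n)" by simp
  then have s: "(-1 :: 'k) ^ (Suc n * n) = 1" by (rule neg_one_even_power)
  have "connes_pure N (tensor w) =
    (\<Sum>i\<le>n. Poly_Mapping.single (1, twisted_rotation N i a0 as) ((-1 :: 'k) ^ (i * n)))"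
    by (simp add: connes_pure_def w as)
  also have "\<dots> = Poly_Mapping.single (1, (rot N ^^ n) w) 1 +
     (\<Sum>l<n. Poly_Mapping.single (1, (rot N ^^ l) w) ((-1) ^ (Suc l * n)))"
    unfolding lessThan_Suc_atMost[symmetric] sum.lessThan_Suc_shift by (simp add: r r0)
  also have "\<dots> = (\<Sum>l\<le>n. Poly_Mapping.single (1, (rot N ^^ l) w) ((-1) ^ (Suc l * n)))"
    unfolding lessThan_Suc_atMost[symmetric] sum.lessThan_Suc s by (simp add: add.commute)
  finally show ?thesis by simp
qed

lemma face_face:
  fixes w :: "'a::semigroup_mult list"
  assumes w: "length w = Suc (Suc (Suc m))" and N: "\<And>a b. N (a * b) = N a * N b"
    and ij: "i \<le> j" "j \<le> Suc m"
  shows "face N i (face N (Suc j) w) = face N j (face N i w)"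
proof (cases i)
  case (Suc i')
  with ij w show ?thesis
    by (cases j) (auto simp: face_def intro!: mult_at_mult_at)
next
  case 0
  have [simp]: "w \<noteq> []" "length (rot N w) = Suc (Suc (Suc m))" "rot N w \<noteq> []"
    using w length_rot[of w N] by (auto simp: rot_def)
  show ?thesis
  proof (cases j)
    case (Suc j')
    with ij w have "rot N (mult_at (Suc j') w) = mult_at j' (rot N w)"
      by (intro rot_mult_at_Suc) simp
    moreover have "mult_at j' (mult_at (Suc m) (rot N w)) = mult_at m (mult_at j' (rot N w))"
      using ij Suc by (intro mult_at_mult_at) auto
    ultimately show ?thesis
      using w 0 Suc ij by (simp add: face_def)
  next
    case j: 0
    have "rot N (mult_at 0 w) = mult_at (Suc m) (rot N (rot N w))"
      using w N by (intro rot_mult_at_0) auto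
    moreover have "rot N (mult_at (Suc m) (rot N w)) = mult_at m (rot N (rot N w))"
      by (rule rot_mult_at_Suc) simp
    moreover have "mult_at m (mult_at (Suc m) (rot N (rot N w))) = mult_at m (mult_at m (rot N (rot N w)))"
      by (rule mult_at_mult_at) simp_all
    ultimately show ?thesis
      using w 0 j by (simp add: face_def)
  qed
qed

text \<open>
  The usual cancellation: the terms with \<open>i < j\<close> and those with \<open>j \<le> i\<close> are matched by
  \<open>(i, j + 1) \<leftrightarrow> (j, i)\<close>, with opposite signs.
\<close>

lemma alternating_double_sum:
  fixes D :: "nat \<Rightarrow> nat \<Rightarrow> 't"
  assumes "\<And>i j. i \<le> j \<Longrightarrow> j \<le> p \<Longrightarrow> D i (Suc j) = D j i"
  shows "(\<Sum>j\<le>Suc p. \<Sum>i\<le>p. Poly_Mapping.single (D i j) ((-1 :: 'k::field) ^ (i + j))) = 0"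
proof -
  let ?f = "\<lambda>(j, i). Poly_Mapping.single (D i j) ((-1 :: 'k) ^ (i + j))"
  let ?A = "{(j, i). i < j \<and> j \<le> Suc p}" and ?B = "{(j, i). j \<le> i \<and> i \<le> p}"
  have AB: "{..Suc p} \<times> {..p} = ?A \<union> ?B" "?A \<inter> ?B = {}" by auto
  have fin: "finite ?A" "finite ?B"
    by (rule finite_subset[of _ "{..Suc p} \<times> {..p}"]; auto)+
  have "sum ?f ?A = (\<Sum>x\<in>?B. - ?f x)"
    by (rule sum.reindex_bij_witness[where i = "\<lambda>(i, j). (Suc j, i)" and j = "\<lambda>(j, i). (i, j - 1)"])
      (auto simp: less_Suc_eq_le gr0_conv_Suc assms add.commute single_uminus
        dest!: less_imp_Suc_add)
  then have "sum ?f (?A \<union> ?B) = 0"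
    using fin AB(2) by (simp add: sum.union_disjoint sum_negf)
  then show ?thesis
    unfolding sum.cartesian_product AB(1) .
qed

section \<open>The chain identities\<close>

lemma rot_pow_face:
  assumes w: "length w = Suc (Suc m)" and N: "\<And>a b. N (a * b) = N a * N b"
    and kl: "k \<le> Suc m" "l \<le> m"
  shows "(rot N ^^ l) (face N k w) =
    (if l < k then mult_at (k - 1 - l) ((rot N ^^ l) w) else mult_at (m + k - l) ((rot N ^^ Suc l) w))"
proof (cases k)
  case 0
  have "w \<noteq> []" using w by auto
  then have "length (rot N w) = Suc (Suc m)" using w by simp
  from rot_pow_mult_at[OF this, of m N l] show ?thesis
    using N kl 0 w by (simp add: face_def funpow_swap1)
next
  case (Suc k')
  with rot_pow_mult_at[OF w, of k' N l] N kl w show ?thesis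
    by (auto simp: face_def)
qed

lemma neg_one_power_cong: "even (a + b) \<Longrightarrow> (-1 :: 'k::ring_1) ^ a = (-1) ^ b"
  by (auto simp: minus_one_power_iff)

text \<open>
  Let \<open>W\<^sub>l\<close> be the \<open>l\<close>-th rotation of \<open>w\<close>, so that \<open>B w\<close> is the signed sum of the \<open>1 \<otimes> W\<^sub>l\<close>. In \<open>b (1 \<otimes> W\<^sub>l)\<close>
  the first face gives \<open>W\<^sub>l\<^sub>+\<^sub>1\<close> and the last face \<open>W\<^sub>l\<close>; these telescope to the full rotation of \<open>w\<close>, which is
  \<open>N\<close> applied to every letter, minus \<open>w\<close>. The inner faces are the \<open>1 \<otimes> mult_at i W\<^sub>l\<close>, each once for every
  \<open>l \<le> n\<close> and \<open>i < n\<close>. By \<open>rot_pow_face\<close> the same terms make up \<open>B (b w)\<close>, with opposite sign. The identity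
  holds in the free space, before tensor relations are imposed.
\<close>

lemma connes_homotopy_tensor:
  fixes N :: "'a::{ring, monoid_mult} \<Rightarrow> 'a" and scale :: "'k::field \<Rightarrow> 'a \<Rightarrow> 'a"
  assumes w: "length w = Suc n" and N: "\<And>a b. N (a * b) = N a * N b"
  defines "b \<equiv> hoch_boundary_pure (twisted_bimodule scale N)"
  shows "lin_ext b (connes_pure N (tensor w)) + lin_ext (connes_pure N) (b (tensor w)) =
    Poly_Mapping.single (tensor (map N w)) 1 - Poly_Mapping.single (tensor w) 1"
proof -
  define W where "W l = (rot N ^^ l) w" for l
  have W: "length (W l) = Suc n" for l
  proof -
    have "w \<noteq> []" using w by auto
    then show ?thesis using w by (simp add: W_def)
  qed
  have W_Suc: "rot N (W l) = W (Suc l)" for l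
    by (simp add: W_def)
  define X where "X j i = tensor (mult_at i (W j) @ [1])" for j i
  define g where "g l = Poly_Mapping.single (tensor (W l)) ((-1 :: 'k) ^ (l * n))" for l
  define Y where "Y = (\<Sum>j\<le>n. \<Sum>i<n. Poly_Mapping.single (X j i) ((-1 :: 'k) ^ (Suc j * n + i)))"
  have bB: "lin_ext b (connes_pure N (tensor w)) = g (Suc n) - g 0 - Y"
  proof -
    have summand: "fscale ((-1) ^ (Suc l * n)) (b (tensor (W l @ [1]))) =
        g (Suc l) - g l - (\<Sum>i<n. Poly_Mapping.single (X l i) ((-1) ^ (Suc l * n + i)))" for l
    proof -
      have f0: "face N 0 (W l @ [1]) = W (Suc l)"
      proof -
        obtain x r where "W l = x # r" "length r = n" using W[of l] by (metis length_Suc_conv)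
        with W_Suc[of l] show ?thesis
          by (simp add: face_def mult_at_append_pair)
      qed
      have fi: "face N (Suc i) (W l @ [1]) = mult_at i (W l) @ [1]" if "i < n" for i
        using that W[of l] by (simp add: face_def mult_at_append)
      have fn: "face N (Suc n) (W l @ [1]) = W l"
      proof -
        obtain x r where "W l = r @ [x]" "length r = n"
          using W[of l] by (metis length_append_singleton rev_exhaust length_0_conv nat.distinct(1) Suc_inject)
        then show ?thesis
          by (simp add: face_def mult_at_append_pair)
      qed
      have "b (tensor (W l @ [1])) = Poly_Mapping.single (tensor (W (Suc l))) 1
          + ((\<Sum>i<n. Poly_Mapping.single (X l i) ((-1) ^ Suc i))
          + Poly_Mapping.single (tensor (W l)) ((-1) ^ Suc n))"
        using W[of l] unfolding b_def
        by (subst boundary_tensor[of _ n], simp, unfold sum_atMost_Suc_ends)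
          (simp add: f0 fi fn X_def)
      moreover have sign: "(-1 :: 'k) ^ n * (-1) ^ (l * n) * (-1) ^ n = (-1) ^ (l * n)"
        unfolding power_add[symmetric] by (rule neg_one_power_cong) auto
      ultimately show ?thesis
        by (simp add: free_space.scale_right_distrib free_space.scale_right_diff_distrib
            free_space.scale_minus_right free_space.scale_sum_right g_def power_add single_uminus sum_negf sign)
    qed
    have "lin_ext b (connes_pure N (tensor w)) =
        (\<Sum>l\<le>n. fscale ((-1) ^ (Suc l * n)) (b (tensor (W l @ [1]))))"
      by (simp add: connes_tensor[OF w] linear_map_sum[OF linear_lin_ext] W_def)
    also have "\<dots> = (\<Sum>l<Suc n. g (Suc l) - g l) - Y"
      by (simp only: summand sum_subtractf Y_def lessThan_Suc_atMost)
    also have "(\<Sum>l<Suc n. g (Suc l) - g l) = g (Suc n) - g 0"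
      by (rule sum_lessThan_telescope)
    finally show ?thesis .
  qed
  have Bb: "lin_ext (connes_pure N) (b (tensor w)) = Y"
  proof (cases n)
    case 0
    then have "b (tensor w) = 0"
      using w by (auto simp: b_def tensor_def hoch_boundary_pure_def length_Suc_conv)
    then show ?thesis
      by (simp add: Y_def 0 linear_map_zero[OF linear_lin_ext])
  next
    case (Suc m)
    have w': "length w = Suc (Suc m)" using w Suc by simp
    have "lin_ext (connes_pure N) (b (tensor w)) =
       (\<Sum>k\<le>n. \<Sum>l<n. Poly_Mapping.single (tensor ((rot N ^^ l) (face N k w) @ [1]))
         ((-1) ^ k * (-1) ^ (Suc l * m)))"
      unfolding b_def boundary_tensor[OF w']
      by (simp add: linear_map_sum[OF linear_lin_ext] connes_tensor length_face[OF w'] Suc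
          free_space.scale_sum_right lessThan_Suc_atMost del: sum.atMost_Suc)
    also have "\<dots> = (\<Sum>(k, l)\<in>{..n} \<times> {..<n}. Poly_Mapping.single
        (if l < k then X l (k - 1 - l) else X (Suc l) (m + k - l)) ((-1) ^ (k + Suc l * m)))"
      unfolding sum.cartesian_product
      by (rule sum.cong) (auto simp: rot_pow_face[OF w' N] Suc X_def W_def power_add)
    also have "\<dots> = (\<Sum>(j, i)\<in>{..n} \<times> {..<n}. Poly_Mapping.single (X j i) ((-1) ^ (Suc j * n + i)))"
      \<comment> \<open>The pair \<open>(k, l)\<close> names the \<open>l\<close>-th rotation of face \<open>k\<close>, and \<open>(j, i)\<close> the product at \<open>i\<close> in \<open>W\<^sub>j\<close>.\<close>
    proof (rule sum.reindex_bij_witness[where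
          j = "\<lambda>(k, l). if l < k then (l, k - 1 - l) else (Suc l, m + k - l)" and
          i = "\<lambda>(j, i). if i + j < n then (Suc (i + j), j) else (i + j - n, j - 1)"], goal_cases)
      case (5 x)
      obtain k l where x: "x = (k, l)" "k \<le> n" "l < n" using 5 by auto
      show ?case
      proof (cases "l < k")
        case True
        then obtain d where "k = Suc (l + d)" by (auto dest: less_imp_Suc_add)
        then show ?thesis using x Suc by (simp add: algebra_simps)
      next
        case False
        then obtain d where d: "l = k + d" by (metis not_less le_iff_add)
        moreover obtain e where "m = l + e" using x Suc by (metis less_Suc_eq_le le_iff_add)
        ultimately show ?thesis using x Suc
          by (auto intro!: arg_cong[where f = "Poly_Mapping.single _"] neg_one_power_cong)
      qed
    qed (auto simp: Suc split: if_splits)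
    finally show ?thesis unfolding Y_def sum.cartesian_product .
  qed
  have "g (Suc n) = Poly_Mapping.single (tensor (map N w)) 1"
  proof -
    have "W (Suc n) = map N w" using w rot_pow[of "Suc n" w N] by (simp add: W_def)
    moreover have "(-1 :: 'k) ^ (Suc n * n) = 1" by (rule neg_one_even_power) simp
    ultimately show ?thesis by (simp only: g_def)
  qed
  moreover have "g 0 = Poly_Mapping.single (tensor w) 1"
    by (simp add: g_def W_def)
  ultimately show ?thesis
    unfolding bB Bb by simp
qed

lemma boundary_boundary_tensor:
  fixes N :: "'a::{ring, monoid_mult} \<Rightarrow> 'a" and scale :: "'k::field \<Rightarrow> 'a \<Rightarrow> 'a"
  assumes w: "length w = Suc n" and N: "\<And>a b. N (a * b) = N a * N b"
  defines "b \<equiv> hoch_boundary_pure (twisted_bimodule scale N)"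
  shows "lin_ext b (b (tensor w)) = 0"
proof -
  have zero: "b (tensor v) = 0" if "length v = 1" for v
    using that by (auto simp: b_def tensor_def hoch_boundary_pure_def length_Suc_conv)
  consider "n = 0" | "n = 1" | m where "n = Suc (Suc m)"
    by (metis not0_implies_Suc One_nat_def)
  then show ?thesis
  proof cases
    case 1
    then show ?thesis using zero[of w] w by (simp add: linear_map_zero[OF linear_lin_ext])
  next
    case 2
    then have w': "length w = Suc (Suc 0)" using w by simp
    have "b (tensor w) = (\<Sum>k\<le>Suc 0. Poly_Mapping.single (tensor (face N k w)) ((-1) ^ k))"
      unfolding b_def by (rule boundary_tensor[OF w'])
    then show ?thesis
      by (simp add: linear_map_add[OF linear_lin_ext] zero length_face[OF w'])
  next
    case (3 m)
    then have w': "length w = Suc (Suc (Suc m))" using w by simp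
    have "lin_ext b (b (tensor w)) = (\<Sum>j\<le>Suc (Suc m). fscale ((-1) ^ j) (b (tensor (face N j w))))"
      unfolding b_def boundary_tensor[OF w']
      by (simp add: linear_map_sum[OF linear_lin_ext] del: sum.atMost_Suc)
    also have "\<dots> = (\<Sum>j\<le>Suc (Suc m). \<Sum>i\<le>Suc m.
        Poly_Mapping.single (tensor (face N i (face N j w))) ((-1) ^ (i + j)))"
      unfolding b_def using boundary_tensor[of _ m scale N] length_face[OF w']
      by (intro sum.cong) (simp_all add: free_space.scale_sum_right power_add mult.commute del: sum.atMost_Suc)
    also have "\<dots> = 0"
      using face_face[OF w' N] by (intro alternating_double_sum) simp
    finally show ?thesis .
  qed
qed

section \<open>Compatibility with the tensor relations\<close>

text \<open>
  Boundary, Connes map and diagonal action are signed sums of maps of words that are multilinear in a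
  strong sense: each letter of the argument affects, linearly, exactly one letter of the value. This
  property is stable under composition and suffices to map tensor relations to tensor
  relations (\<open>lin_ext_preserves\<close>), which treats all three maps at once.
\<close>

definition slotwise_linear ::
    "('k::field \<Rightarrow> 'a::ab_group_add \<Rightarrow> 'a) \<Rightarrow> nat \<Rightarrow> nat \<Rightarrow> ('a list \<Rightarrow> 'a list) \<Rightarrow> bool" where
  "slotwise_linear scale m m' \<phi> \<longleftrightarrow>
    (\<forall>w. length w = m \<longrightarrow> length (\<phi> w) = m') \<and>
    (\<forall>w p. length w = m \<and> p < m \<longrightarrow>
      (\<exists>q<m'. \<exists>h. Vector_Spaces.linear scale scale h \<and> (\<forall>a. \<phi> (w[p := a]) = (\<phi> w)[q := h a])))"

lemma slotwise_linearI:
  assumes "\<And>w. length w = m \<Longrightarrow> length (\<phi> w) = m'"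
    and "\<And>w p. length w = m \<Longrightarrow> p < m \<Longrightarrow>
      \<exists>q<m'. \<exists>h. Vector_Spaces.linear scale scale h \<and> (\<forall>a. \<phi> (w[p := a]) = (\<phi> w)[q := h a])"
  shows "slotwise_linear scale m m' \<phi>"
  using assms by (auto simp: slotwise_linear_def)

lemma slotwise_linear_compose:
  assumes "slotwise_linear scale m m' \<phi>" "slotwise_linear scale m' m'' \<psi>"
  shows "slotwise_linear scale m m'' (\<lambda>w. \<psi> (\<phi> w))"
proof (rule slotwise_linearI)
  fix w :: "'b list" and p
  assume w: "length w = m" and "p < m"
  then obtain q h where h: "q < m'" "Vector_Spaces.linear scale scale h" "\<And>a. \<phi> (w[p := a]) = (\<phi> w)[q := h a]"
    using assms(1) unfolding slotwise_linear_def by blast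
  moreover have "length (\<phi> w) = m'" using assms(1) w by (simp add: slotwise_linear_def)
  ultimately obtain r h' where "r < m''" "Vector_Spaces.linear scale scale h'"
      "\<And>a. \<psi> ((\<phi> w)[q := a]) = (\<psi> (\<phi> w))[r := h' a]"
    using assms(2) unfolding slotwise_linear_def by blast
  with h show "\<exists>r<m''. \<exists>h. Vector_Spaces.linear scale scale h \<and> (\<forall>a. \<psi> (\<phi> (w[p := a])) = (\<psi> (\<phi> w))[r := h a])"
    by (intro exI[of _ r] conjI exI[of _ "\<lambda>a. h' (h a)"]) (auto intro: linear_map_compose)
qed (use assms in \<open>auto simp: slotwise_linear_def\<close>)

lemma slotwise_linear_pow:
  assumes "slotwise_linear scale m m \<phi>" and "Vector_Spaces.linear scale scale id"
  shows "slotwise_linear scale m m (\<phi> ^^ l)"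
proof (induction l)
  case 0
  show ?case
    using assms(2) by (intro slotwise_linearI) (auto simp: id_def)
next
  case (Suc l)
  then show ?case
    using slotwise_linear_compose[OF _ assms(1)] by (simp add: comp_def)
qed

locale nakayama_algebra = frobenius_algebra scale form
  for scale :: "'k::field \<Rightarrow> 'a::{ring, monoid_mult} \<Rightarrow> 'a" and form :: "'a \<Rightarrow> 'a \<Rightarrow> 'k" +
  fixes N :: "'a \<Rightarrow> 'a"
  assumes nakayama: "nakayama_automorphism scale form N"
begin

lemma linear_N: "Vector_Spaces.linear scale scale N"
  and N_mult: "N (a * b) = N a * N b"
  and form_N: "form a b = form b (N a)"
  and bij_N: "bij N"
  using nakayama by (auto simp: nakayama_automorphism_def algebra_automorphism_def)

lemma form_N_N: "form (N a) (N b) = form a b"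
  using form_N[of a b] form_N[of b "N a"] by simp

lemma form_add_left: "form (a + a') b = form a b + form a' b"
  and form_diff_left: "form (a - a') b = form a b - form a' b"
  and form_scale_left: "form (scale t a) b = t * form a b"
  by (rule linear_map_add[OF form_linear_left] linear_map_diff[OF form_linear_left] linear_map_scale[OF form_linear_left])+

lemma form_add_right: "form a (b + b') = form a b + form a b'"
  and form_scale_right: "form a (scale t b) = t * form a b"
  by (rule linear_map_add[OF form_linear_right] linear_map_scale[OF form_linear_right])+

lemma form_eqI: "(\<And>b. form a b = form a' b) \<Longrightarrow> a = a'"
  using form_nondegenerate_left[of "a - a'"] by (simp add: form_diff_left)

text \<open>
  \<open>C n\<close> are the chains before tensor relations \<open>R n\<close> are imposed; \<open>bnd\<close>, \<open>connes\<close> and \<open>T\<close> act on the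
  free space in all degrees at once.
\<close>

abbreviation M :: "('k, 'a, 'a) bimodule" where "M \<equiv> twisted_bimodule scale N"

abbreviation C :: "nat \<Rightarrow> ('k, 'a, 'a) free_chain set" where "C \<equiv> free_chains M"

abbreviation R :: "nat \<Rightarrow> ('k, 'a, 'a) free_chain set" where "R \<equiv> tensor_relations scale M"

abbreviation bnd :: "('k, 'a, 'a) free_chain \<Rightarrow> ('k, 'a, 'a) free_chain" where
  "bnd \<equiv> lin_ext (hoch_boundary_pure M)"

abbreviation connes :: "('k, 'a, 'a) free_chain \<Rightarrow> ('k, 'a, 'a) free_chain" where
  "connes \<equiv> lin_ext (connes_pure N)"

abbreviation T :: "('k, 'a, 'a) free_chain \<Rightarrow> ('k, 'a, 'a) free_chain" where
  "T \<equiv> lin_ext (\<lambda>(a0, as). Poly_Mapping.single (N a0, map N as) 1)"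

lemma slotwise_linear_id: "Vector_Spaces.linear scale scale id"
  by (simp add: Vector_Spaces.linear_iff vector_space_axioms)

lemma slotwise_linear_rot: "slotwise_linear scale (Suc n) (Suc n) (rot N)"
proof (rule slotwise_linearI)
  fix w :: "'a list" and p
  assume w: "length w = Suc n" "p < Suc n"
  then obtain x r where xr: "w = x # r" "length r = n" by (metis length_Suc_conv)
  show "\<exists>q<Suc n. \<exists>h. Vector_Spaces.linear scale scale h \<and> (\<forall>a. rot N (w[p := a]) = (rot N w)[q := h a])"
  proof (cases p)
    case 0
    then show ?thesis using xr linear_N
      by (intro exI[of _ n] conjI exI[of _ N]) (auto simp: list_update_append)
  next
    case (Suc q)
    then show ?thesis using xr w slotwise_linear_id
      by (intro exI[of _ q] conjI exI[of _ id]) (auto simp: list_update_append)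
  qed
qed (simp flip: length_greater_0_conv)

lemma slotwise_linear_map: "slotwise_linear scale n n (map N)"
  using linear_N by (intro slotwise_linearI) (auto simp: map_update)

lemma slotwise_linear_snoc: "slotwise_linear scale n (Suc n) (\<lambda>w. w @ [a])"
proof (rule slotwise_linearI)
  fix w :: "'a list" and p assume "length w = n" "p < n"
  then show "\<exists>q<Suc n. \<exists>h. Vector_Spaces.linear scale scale h \<and> (\<forall>b. w[p := b] @ [a] = (w @ [a])[q := h b])"
    using slotwise_linear_id
    by (intro exI[of _ p] conjI exI[of _ id]) (simp_all add: list_update_append)
qed simp

lemma slotwise_linear_mult_at:
  assumes "i \<le> n"
  shows "slotwise_linear scale (Suc (Suc n)) (Suc n) (mult_at i)"
proof (rule slotwise_linearI)
  fix w :: "'a list" and p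
  assume w: "length w = Suc (Suc n)" "p < Suc (Suc n)"
  have left: "Vector_Spaces.linear scale scale (\<lambda>a. a * x)"
    and right: "Vector_Spaces.linear scale scale (\<lambda>a. x * a)" for x
    by (simp_all add: Vector_Spaces.linear_iff vector_space_axioms algebra_simps
        scale_mult_left[symmetric] scale_mult_right[symmetric])
  consider "p < i" | "p = i" | "p = Suc i" | "p > Suc i" by linarith
  then show "\<exists>q<Suc n. \<exists>h. Vector_Spaces.linear scale scale h \<and> (\<forall>a. mult_at i (w[p := a]) = (mult_at i w)[q := h a])"
  proof cases
    case 1
    then show ?thesis using assms w slotwise_linear_id
      by (intro exI[of _ p] conjI exI[of _ id])
        (auto intro!: nth_equalityI simp: nth_mult_at nth_list_update)
  next
    case 2
    then show ?thesis using assms w left[of "w ! Suc i"]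
      by (intro exI[of _ i] conjI exI[of _ "\<lambda>a. a * w ! Suc i"])
        (auto intro!: nth_equalityI simp: nth_mult_at nth_list_update)
  next
    case 3
    then show ?thesis using assms w right[of "w ! i"]
      by (intro exI[of _ i] conjI exI[of _ "\<lambda>a. w ! i * a"])
        (auto intro!: nth_equalityI simp: nth_mult_at nth_list_update)
  next
    case 4
    then show ?thesis using assms w slotwise_linear_id
      by (intro exI[of _ "p - 1"] conjI exI[of _ id])
        (auto intro!: nth_equalityI simp: nth_mult_at nth_list_update)
  qed
qed (use assms in simp)

lemma slotwise_linear_face:
  assumes "k \<le> Suc n"
  shows "slotwise_linear scale (Suc (Suc n)) (Suc n) (face N k)"
proof (cases k)
  case 0
  have "slotwise_linear scale (Suc (Suc n)) (Suc n) (\<lambda>w. mult_at n (rot N w))"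
    by (rule slotwise_linear_compose[OF slotwise_linear_rot slotwise_linear_mult_at]) simp
  then show ?thesis
    by (simp add: 0 face_def slotwise_linear_def)
next
  case (Suc i)
  then show ?thesis
    using slotwise_linear_mult_at[of i n] assms by (simp add: face_def[abs_def])
qed

text \<open>
  The generators of \<open>tensor_relations\<close> in terms of words, where the coefficient is a letter like the
  others; four families become two.
\<close>

definition slot_relations :: "nat \<Rightarrow> ('k, 'a, 'a) free_chain set" where
  "slot_relations n =
     {Poly_Mapping.single (tensor (w[p := a + b])) 1 - Poly_Mapping.single (tensor (w[p := a])) 1
         - Poly_Mapping.single (tensor (w[p := b])) 1 | w p a b. length w = Suc n \<and> p < Suc n} \<union>
     {Poly_Mapping.single (tensor (w[p := scale t a])) 1 - Poly_Mapping.single (tensor (w[p := a])) t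
       | w p t a. length w = Suc n \<and> p < Suc n}"

lemma slot_relation_add:
  "length w = Suc n \<Longrightarrow> p < Suc n \<Longrightarrow>
    Poly_Mapping.single (tensor (w[p := a + b])) 1 - Poly_Mapping.single (tensor (w[p := a])) 1
      - Poly_Mapping.single (tensor (w[p := b])) 1 \<in> slot_relations n"
  unfolding slot_relations_def by blast

lemma slot_relation_scale:
  "length w = Suc n \<Longrightarrow> p < Suc n \<Longrightarrow>
    Poly_Mapping.single (tensor (w[p := scale t a])) 1 - Poly_Mapping.single (tensor (w[p := a])) t
      \<in> slot_relations n"
  unfolding slot_relations_def by blast

lemma tensor_update_last: "length as = n \<Longrightarrow> tensor ((as @ [m])[n := a]) = (a, as)"
  by (simp add: list_update_append)

lemma tensor_update_inner:
  "length as + length bs + 1 = n \<Longrightarrow>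
    tensor (((as @ x # bs) @ [m])[length as := a]) = (m, as @ a # bs)"
  by (simp add: tensor_def list_update_append butlast_append)

lemma word_slot_cases:
  assumes "length w = Suc n" "p < Suc n"
  obtains (last) as m where "w = as @ [m]" "length as = n" "p = n"
  | (inner) as x bs m where "w = (as @ x # bs) @ [m]" "length as + length bs + 1 = n" "p = length as"
proof -
  obtain v m where v: "w = v @ [m]" "length v = n"
    using assms by (metis length_append_singleton rev_exhaust length_0_conv nat.distinct(1) Suc_inject)
  show thesis
  proof (cases "p = n")
    case True
    with v last show thesis by blast
  next
    case False
    then have "p < length v" using assms v by simp
    then have "v = take p v @ v ! p # drop (Suc p) v" by (rule id_take_nth_drop)
    with inner[of "take p v" "v ! p" "drop (Suc p) v" m] v \<open>p < length v\<close> show thesis by simp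
  qed
qed

lemma tensor_relations_eq: "R n = free_space.span (slot_relations n)"
proof -
  let ?G1 = "{Poly_Mapping.single (m + m', as) 1 - Poly_Mapping.single (m, as) 1
         - Poly_Mapping.single (m', as) (1::'k) | m m' (as::'a list). m \<in> carr M \<and> m' \<in> carr M \<and> length as = n}"
  let ?G2 = "{Poly_Mapping.single (scl M t m, as) 1 - Poly_Mapping.single (m, as) t
        | t m (as::'a list). m \<in> carr M \<and> length as = n}"
  let ?G3 = "{Poly_Mapping.single (m, as @ (a + a') # bs) 1 - Poly_Mapping.single (m, as @ a # bs) 1
         - Poly_Mapping.single (m, as @ a' # bs) (1::'k)
        | m as a a' bs. m \<in> carr M \<and> length as + length bs + 1 = n}"
  let ?G4 = "{Poly_Mapping.single (m, as @ scale t a # bs) 1 - Poly_Mapping.single (m, as @ a # bs) t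
        | t m as a bs. m \<in> carr M \<and> length as + length bs + 1 = n}"
  have M: "carr M = UNIV" "scl M = scale" by (simp_all add: twisted_bimodule_def)
  have "?G1 \<union> ?G2 \<union> ?G3 \<union> ?G4 = slot_relations n"
  proof (intro equalityI subsetI)
    fix x assume "x \<in> ?G1 \<union> ?G2 \<union> ?G3 \<union> ?G4"
    then consider "x \<in> ?G1" | "x \<in> ?G2" | "x \<in> ?G3" | "x \<in> ?G4" by blast
    then show "x \<in> slot_relations n"
    proof cases
      case 1
      then obtain m m' as where x: "x = Poly_Mapping.single (m + m', as) 1 - Poly_Mapping.single (m, as) 1
         - Poly_Mapping.single (m', as) (1::'k)" "length as = n" by blast
      show ?thesis unfolding x(1)
        using x(2) slot_relation_add[of "as @ [0]" n n m m']
        unfolding tensor_update_last[OF x(2)] by fastforce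
    next
      case 2
      then obtain t m as where x: "x = Poly_Mapping.single (scale t m, as) 1 - Poly_Mapping.single (m, as) t"
         "length as = n" unfolding M by blast
      show ?thesis unfolding x(1)
        using x(2) slot_relation_scale[of "as @ [0]" n n t m]
        unfolding tensor_update_last[OF x(2)] by fastforce
    next
      case 3
      then obtain m as a a' bs where x: "x = Poly_Mapping.single (m, as @ (a + a') # bs) 1
          - Poly_Mapping.single (m, as @ a # bs) 1 - Poly_Mapping.single (m, as @ a' # bs) (1::'k)"
          "length as + length bs + 1 = n" by blast
      show ?thesis unfolding x(1)
        using x(2) slot_relation_add[of "(as @ 0 # bs) @ [m]" n "length as" a a']
        unfolding tensor_update_inner[OF x(2)] by fastforce
    next
      case 4
      then obtain t m as a bs where x: "x = Poly_Mapping.single (m, as @ scale t a # bs) 1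
          - Poly_Mapping.single (m, as @ a # bs) t" "length as + length bs + 1 = n" by blast
      show ?thesis unfolding x(1)
        using x(2) slot_relation_scale[of "(as @ 0 # bs) @ [m]" n "length as" t a]
        unfolding tensor_update_inner[OF x(2)] by fastforce
    qed
  next
    fix x assume "x \<in> slot_relations n"
    then consider (add) w p a b where "length w = Suc n" "p < Suc n"
        "x = Poly_Mapping.single (tensor (w[p := a + b])) 1 - Poly_Mapping.single (tensor (w[p := a])) 1
         - Poly_Mapping.single (tensor (w[p := b])) 1"
      | (scale) w p t a where "length w = Suc n" "p < Suc n"
        "x = Poly_Mapping.single (tensor (w[p := scale t a])) 1 - Poly_Mapping.single (tensor (w[p := a])) t"
      unfolding slot_relations_def by blast
    then show "x \<in> ?G1 \<union> ?G2 \<union> ?G3 \<union> ?G4"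
    proof cases
      case add
      from add(1,2) show ?thesis
      proof (cases rule: word_slot_cases)
        case (last as m)
        with add(3) have "x \<in> ?G1" unfolding M by (auto simp: tensor_update_last)
        then show ?thesis by blast
      next
        case (inner as y bs m)
        have "x \<in> ?G3" unfolding M add(3) inner(1,3) tensor_update_inner[OF inner(2)] using inner(2) by blast
        then show ?thesis by blast
      qed
    next
      case scale
      from scale(1,2) show ?thesis
      proof (cases rule: word_slot_cases)
        case (last as m)
        with scale(3) have "x \<in> ?G2" unfolding M by (auto simp: tensor_update_last)
        then show ?thesis by blast
      next
        case (inner as y bs m)
        have "x \<in> ?G4" unfolding M scale(3) inner(1,3) tensor_update_inner[OF inner(2)] using inner(2) by blast
        then show ?thesis by blast
      qed
    qed
  qed
  then show ?thesis
    unfolding tensor_relations_def by simp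
qed

lemma subspace_R: "free_space.subspace (R n)"
  unfolding tensor_relations_eq by (rule free_space.subspace_span)

lemma subspace_C: "free_space.subspace (C n)"
proof -
  have "C n = {x. \<forall>t. Poly_Mapping.lookup x t \<noteq> 0 \<longrightarrow> fst t \<in> carr M \<and> length (snd t) = n}"
    by (auto simp: free_chains_def in_keys_iff)
  moreover have "\<dots> = {x. \<forall>t. \<not> (fst t \<in> carr M \<and> length (snd t) = n) \<longrightarrow> Poly_Mapping.lookup x t = 0}"
    by blast
  ultimately show ?thesis
    by (simp add: free_space.subspace_def lookup_add)
qed

lemma C_iff: "x \<in> C n \<longleftrightarrow> (\<forall>t\<in>Poly_Mapping.keys x. \<exists>w. length w = Suc n \<and> t = tensor w)"
proof -
  have "length (snd t) = n \<longleftrightarrow> (\<exists>w. length w = Suc n \<and> t = tensor w)" for t :: "'a \<times> 'a list"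
    by (auto simp: tensor_def intro!: exI[of _ "snd t @ [fst t]"])
  then show ?thesis
    by (auto simp: free_chains_def twisted_bimodule_def case_prod_unfold)
qed

lemma tensor_in_C: "length w = Suc n \<Longrightarrow> Poly_Mapping.single (tensor w) c \<in> C n"
  by (auto simp: C_iff)

lemma linear_eq_on_C:
  assumes "Vector_Spaces.linear fscale s f" "Vector_Spaces.linear fscale s g" "x \<in> C n"
    and "\<And>w. length w = Suc n \<Longrightarrow>
      f (Poly_Mapping.single (tensor w) 1) = g (Poly_Mapping.single (tensor w) 1)"
  shows "f x = g x"
  by (rule linear_eq_on_keys[OF assms(1,2)]) (use assms(3,4) in \<open>auto simp: C_iff\<close>)

lemma lin_ext_preserves:
  assumes F: "\<And>w. length w = Suc n \<Longrightarrow>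
      F (tensor w) = (\<Sum>k\<in>K. Poly_Mapping.single (tensor (\<phi> k w)) (c k))"
    and \<phi>: "\<And>k. k \<in> K \<Longrightarrow> slotwise_linear scale (Suc n) (Suc n') (\<phi> k)"
  shows "x \<in> C n \<Longrightarrow> lin_ext F x \<in> C n'"
    and "r \<in> R n \<Longrightarrow> lin_ext F r \<in> R n'"
proof -
  assume x: "x \<in> C n"
  have "F t \<in> C n'" if t: "t \<in> Poly_Mapping.keys x" for t
  proof -
    obtain w where "length w = Suc n" "t = tensor w" using x t by (auto simp: C_iff)
    with F \<phi> show ?thesis
      by (auto simp: slotwise_linear_def intro!: free_space.subspace_sum[OF subspace_C] tensor_in_C)
  qed
  then show "lin_ext F x \<in> C n'"
    unfolding lin_ext_def
    by (intro free_space.subspace_sum[OF subspace_C] free_space.subspace_scale[OF subspace_C])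
next
  have sum: "(\<Sum>k\<in>K. fscale (c k) (g k)) \<in> R n'" if "\<And>k. k \<in> K \<Longrightarrow> g k \<in> slot_relations n'" for g
    unfolding tensor_relations_eq using that
    by (intro free_space.span_sum free_space.span_scale free_space.span_base)
  assume "r \<in> R n"
  then show "lin_ext F r \<in> R n'"
    unfolding tensor_relations_eq
  proof (induction rule: free_space.span_induct)
    case base
    show ?case
      by (auto simp: free_space.subspace_def linear_map_zero[OF linear_lin_ext] linear_map_add[OF linear_lin_ext]
          linear_map_scale[OF linear_lin_ext] free_space.span_zero free_space.span_add free_space.span_scale)
  next
    case (step x)
    then consider (add) w p a b where "length w = Suc n" "p < Suc n"
        "x = Poly_Mapping.single (tensor (w[p := a + b])) 1 - Poly_Mapping.single (tensor (w[p := a])) 1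
         - Poly_Mapping.single (tensor (w[p := b])) 1"
      | (scale) w p t a where "length w = Suc n" "p < Suc n"
        "x = Poly_Mapping.single (tensor (w[p := scale t a])) 1 - Poly_Mapping.single (tensor (w[p := a])) t"
      unfolding slot_relations_def by blast
    then show ?case
    proof cases
      case add
      let ?g = "\<lambda>k. Poly_Mapping.single (tensor (\<phi> k (w[p := a + b]))) 1
          - Poly_Mapping.single (tensor (\<phi> k (w[p := a]))) 1 - Poly_Mapping.single (tensor (\<phi> k (w[p := b]))) 1"
      have "?g k \<in> slot_relations n'" if k: "k \<in> K" for k
      proof -
        obtain q h where q: "q < Suc n'" "Vector_Spaces.linear scale scale h"
            "\<And>a. \<phi> k (w[p := a]) = (\<phi> k w)[q := h a]" "length (\<phi> k w) = Suc n'"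
          using \<phi>[OF k] add(1,2) unfolding slotwise_linear_def by blast
        then show ?thesis
          unfolding q(3) linear_map_add[OF q(2)] slot_relations_def by blast
      qed
      then have "(\<Sum>k\<in>K. fscale (c k) (?g k)) \<in> R n'" by (rule sum)
      also have "(\<Sum>k\<in>K. fscale (c k) (?g k)) = lin_ext F x"
        using add by (simp add: linear_map_diff[OF linear_lin_ext] F free_space.scale_right_diff_distrib sum_subtractf)
      finally show ?thesis unfolding tensor_relations_eq .
    next
      case scale
      let ?g = "\<lambda>k. Poly_Mapping.single (tensor (\<phi> k (w[p := scale t a]))) 1
          - Poly_Mapping.single (tensor (\<phi> k (w[p := a]))) t"
      have "?g k \<in> slot_relations n'" if k: "k \<in> K" for k
      proof -
        obtain q h where q: "q < Suc n'" "Vector_Spaces.linear scale scale h"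
            "\<And>a. \<phi> k (w[p := a]) = (\<phi> k w)[q := h a]" "length (\<phi> k w) = Suc n'"
          using \<phi>[OF k] scale(1,2) unfolding slotwise_linear_def by blast
        then show ?thesis
          unfolding q(3) linear_map_scale[OF q(2)] slot_relations_def by blast
      qed
      then have "(\<Sum>k\<in>K. fscale (c k) (?g k)) \<in> R n'" by (rule sum)
      also have "(\<Sum>k\<in>K. fscale (c k) (?g k)) = lin_ext F x"
        using scale by (simp add: linear_map_diff[OF linear_lin_ext] F free_space.scale_right_diff_distrib
            sum_subtractf free_space.scale_sum_right mult.commute)
      finally show ?thesis unfolding tensor_relations_eq .
    qed
  qed
qed

lemma bnd_C: "x \<in> C (Suc n) \<Longrightarrow> bnd x \<in> C n"
  and bnd_R: "r \<in> R (Suc n) \<Longrightarrow> bnd r \<in> R n"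
  by (rule lin_ext_preserves[OF boundary_tensor slotwise_linear_face]; simp)+

lemma slotwise_linear_rotations: "slotwise_linear scale (Suc n) (Suc (Suc n)) (\<lambda>w. (rot N ^^ l) w @ [1])"
  by (rule slotwise_linear_compose[OF slotwise_linear_pow[OF slotwise_linear_rot slotwise_linear_id] slotwise_linear_snoc])

lemma connes_C: "x \<in> C n \<Longrightarrow> connes x \<in> C (Suc n)"
  and connes_R: "r \<in> R n \<Longrightarrow> connes r \<in> R (Suc n)"
  by (rule lin_ext_preserves[OF connes_tensor slotwise_linear_rotations]; simp)+

lemma T_tensor: "w \<noteq> [] \<Longrightarrow> T (Poly_Mapping.single (tensor w) c) = Poly_Mapping.single (tensor (map N w)) c"
  by (simp add: tensor_def last_map map_butlast)

lemma T_pure: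
  "length w = Suc n \<Longrightarrow> (\<lambda>(a0, as). Poly_Mapping.single (N a0, map N as) 1) (tensor w) =
    (\<Sum>k\<in>{()}. Poly_Mapping.single (tensor (map N w)) 1)"
  by (cases w) (simp_all add: tensor_def last_map map_butlast)

lemma T_C: "x \<in> C n \<Longrightarrow> T x \<in> C n"
  and T_R: "r \<in> R n \<Longrightarrow> T r \<in> R n"
  by (rule lin_ext_preserves[OF T_pure slotwise_linear_map]; simp)+

lemma bnd_C_0:
  assumes "x \<in> C 0" shows "bnd x = 0"
  by (rule linear_eq_on_C[OF linear_lin_ext linear_const_0 assms])
    (auto simp: tensor_def hoch_boundary_pure_def length_Suc_conv)

lemma bnd_bnd:
  assumes "x \<in> C n" shows "bnd (bnd x) = 0"
  by (rule linear_eq_on_C[OF linear_map_compose[OF linear_lin_ext linear_lin_ext] linear_const_0 assms])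
    (simp add: boundary_boundary_tensor N_mult)

lemma connes_homotopy:
  assumes "x \<in> C n" shows "bnd (connes x) + connes (bnd x) = T x - x"
proof (rule linear_eq_on_C[OF _ _ assms])
  show "Vector_Spaces.linear fscale fscale (\<lambda>x. bnd (connes x) + connes (bnd x))"
    by (intro linear_map_pointwise_add linear_map_compose[OF linear_lin_ext linear_lin_ext])
  show "Vector_Spaces.linear fscale fscale (\<lambda>x. T x - x)"
    by (intro linear_map_pointwise_diff linear_lin_ext linear_self)
  show "bnd (connes (Poly_Mapping.single (tensor w) 1)) + connes (bnd (Poly_Mapping.single (tensor w) 1)) =
      T (Poly_Mapping.single (tensor w) 1) - Poly_Mapping.single (tensor w) 1" if "length w = Suc n" for w
    using connes_homotopy_tensor[OF that, of N scale] N_mult that T_tensor[of w 1]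
    by (cases w) simp_all
qed

end

section \<open>Averaging over the powers of the Nakayama automorphism\<close>

lemma linear_fscale: "Vector_Spaces.linear s1 fscale f \<Longrightarrow> Vector_Spaces.linear s1 fscale (\<lambda>x. fscale c (f x))"
  by (simp add: Vector_Spaces.linear_iff free_space.scale_right_distrib mult.commute)

lemma linear_sum_fun:
  "(\<And>i. i \<in> I \<Longrightarrow> Vector_Spaces.linear fscale fscale (f i)) \<Longrightarrow>
    Vector_Spaces.linear fscale fscale (\<lambda>x. \<Sum>i\<in>I. f i x)"
  by (induction I rule: infinite_finite_induct) (auto intro: linear_const_0 linear_map_pointwise_add)

locale averaging_algebra = nakayama_algebra scale form N
  for scale :: "'k::field \<Rightarrow> 'a::{ring, monoid_mult} \<Rightarrow> 'a" and form :: "'a \<Rightarrow> 'a \<Rightarrow> 'k"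
    and N :: "'a \<Rightarrow> 'a" +
  fixes ord :: nat
  assumes N_pow_ord: "N ^^ ord = id"
    and ord_nonzero: "of_nat ord \<noteq> (0 :: 'k)"
begin

text \<open>
  Both \<open>b T - b\<close> and \<open>T b - b\<close> are equal to \<open>b B b\<close> by \<open>connes_homotopy\<close> and \<open>b b = 0\<close>.
\<close>

lemma T_bnd:
  assumes "x \<in> C n"
  shows "bnd (T x) = T (bnd x)"
proof (cases n)
  case 0
  then show ?thesis
    using assms bnd_C_0 T_C by (simp add: linear_map_zero[OF linear_lin_ext])
next
  case (Suc m)
  have b: "bnd x \<in> C m" using assms Suc bnd_C by blast
  have "bnd (T x) - bnd x = bnd (bnd (connes x)) + bnd (connes (bnd x))"
    using connes_homotopy[OF assms]
    by (simp flip: linear_map_diff[OF linear_lin_ext] linear_map_add[OF linear_lin_ext])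
  also have "\<dots> = bnd (connes (bnd x))"
    using bnd_bnd[OF connes_C[OF assms]] by simp
  also have "\<dots> = T (bnd x) - bnd x"
    using connes_homotopy[OF b] bnd_bnd[OF assms] by (simp add: linear_map_zero[OF linear_lin_ext])
  finally show ?thesis by simp
qed

text \<open>
  The properties shared by all polynomials in \<open>T\<close>.
\<close>

definition natural_operator :: "(('k, 'a, 'a) free_chain \<Rightarrow> ('k, 'a, 'a) free_chain) \<Rightarrow> bool" where
  "natural_operator \<phi> \<longleftrightarrow> Vector_Spaces.linear fscale fscale \<phi> \<and>
    (\<forall>n. \<forall>x\<in>C n. \<phi> x \<in> C n \<and> bnd (\<phi> x) = \<phi> (bnd x)) \<and>
    (\<forall>n. \<forall>r\<in>R n. \<phi> r \<in> R n) \<and> (\<forall>x. \<phi> (T x) = T (\<phi> x))"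

lemma natural_operator_pow: "natural_operator (T ^^ j)"
proof (induction j)
  case 0
  then show ?case by (simp add: natural_operator_def id_def linear_self)
next
  case (Suc j)
  have lin: "Vector_Spaces.linear fscale fscale (T ^^ j)"
    using Suc by (simp add: natural_operator_def)
  have C: "(T ^^ j) x \<in> C n" "bnd ((T ^^ j) x) = (T ^^ j) (bnd x)" if "x \<in> C n" for x n
    using Suc that unfolding natural_operator_def by blast+
  have R: "(T ^^ j) r \<in> R n" if "r \<in> R n" for r n
    using Suc that unfolding natural_operator_def by blast
  have comm: "(T ^^ j) (T x) = T ((T ^^ j) x)" for x
    using Suc unfolding natural_operator_def by blast
  show ?case
    unfolding natural_operator_def funpow.simps comp_def
    by (intro conjI allI ballI linear_map_compose[OF lin linear_lin_ext])
      (simp_all only: C T_C R T_R T_bnd[OF C(1)] comm)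
qed

lemma natural_operator_sum:
  assumes "\<And>i. i \<in> I \<Longrightarrow> natural_operator (f i)"
  shows "natural_operator (\<lambda>x. \<Sum>i\<in>I. f i x)"
  using assms unfolding natural_operator_def
  by (auto intro!: linear_sum_fun free_space.subspace_sum[OF subspace_C] free_space.subspace_sum[OF subspace_R] sum.cong
      simp: linear_map_sum[OF linear_lin_ext])

lemma natural_operator_fscale:
  assumes "natural_operator f"
  shows "natural_operator (\<lambda>x. fscale c (f x))"
  using assms unfolding natural_operator_def
  by (auto intro!: linear_fscale free_space.subspace_scale[OF subspace_C] free_space.subspace_scale[OF subspace_R]
      simp: linear_map_scale[OF linear_lin_ext])

definition average :: "('k, 'a, 'a) free_chain \<Rightarrow> ('k, 'a, 'a) free_chain" where
  "average x = fscale (inverse (of_nat ord)) (\<Sum>j<ord. (T ^^ j) x)"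

text \<open>
  The quotient of the polynomial \<open>average - 1\<close> in \<open>T\<close> by \<open>T - 1\<close>.
\<close>

definition average_quotient :: "('k, 'a, 'a) free_chain \<Rightarrow> ('k, 'a, 'a) free_chain" where
  "average_quotient x = fscale (inverse (of_nat ord)) (\<Sum>j<ord. \<Sum>i<j. (T ^^ i) x)"

lemma natural_average: "natural_operator average"
  unfolding average_def[abs_def]
  by (intro natural_operator_fscale natural_operator_sum natural_operator_pow)

lemma natural_average_quotient: "natural_operator average_quotient"
  unfolding average_quotient_def[abs_def]
  by (intro natural_operator_fscale natural_operator_sum natural_operator_pow)

lemma T_pow_ord: "(T ^^ ord) x = x"
proof (rule linear_eq_on_keys)
  show "Vector_Spaces.linear fscale fscale (T ^^ ord)"
    using natural_operator_pow by (simp add: natural_operator_def)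
  show "Vector_Spaces.linear fscale fscale (\<lambda>x. x)" by (rule linear_self)
  have "(T ^^ j) (Poly_Mapping.single (a0, as) 1) = Poly_Mapping.single ((N ^^ j) a0, map (N ^^ j) as) 1" for j a0 as
    by (induction j) (simp_all add: comp_def)
  then show "(T ^^ ord) (Poly_Mapping.single t 1) = Poly_Mapping.single t 1" for t
    by (cases t) (simp add: N_pow_ord)
qed

lemma T_average: "T (average x) = average x"
proof -
  have "(\<Sum>j<ord. (T ^^ Suc j) x) = (\<Sum>j<ord. (T ^^ j) x)"
  proof (cases ord)
    case (Suc m)
    then have "(\<Sum>j<ord. (T ^^ Suc j) x) = (\<Sum>j<m. (T ^^ Suc j) x) + x"
      using T_pow_ord[of x] by simp
    also have "\<dots> = (\<Sum>j<ord. (T ^^ j) x)"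
      unfolding Suc by (subst sum.lessThan_Suc_shift) simp
    finally show ?thesis .
  qed simp
  then show ?thesis
    by (simp add: average_def linear_map_scale[OF linear_lin_ext] linear_map_sum[OF linear_lin_ext])
qed

lemma average_minus_id: "average x - x = T (average_quotient x) - average_quotient x"
proof -
  have "T (average_quotient x) - average_quotient x =
      fscale (inverse (of_nat ord)) (\<Sum>j<ord. \<Sum>i<j. (T ^^ Suc i) x - (T ^^ i) x)"
    by (simp add: average_quotient_def linear_map_scale[OF linear_lin_ext] linear_map_sum[OF linear_lin_ext]
        sum_subtractf free_space.scale_right_diff_distrib)
  also have "\<dots> = fscale (inverse (of_nat ord)) (\<Sum>j<ord. (T ^^ j) x - x)"
    by (subst sum_lessThan_telescope) simp
  also have "\<dots> = average x - fscale (inverse (of_nat ord)) (\<Sum>j<ord. x)"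
    by (simp only: average_def sum_subtractf free_space.scale_right_diff_distrib)
  also have "fscale (inverse (of_nat ord)) (\<Sum>j<ord. x) = x"
  proof -
    have "(\<Sum>j<n. x) = fscale (of_nat n) x" for n :: nat
      by (induction n) (simp_all add: free_space.scale_left_distrib add.commute)
    then show ?thesis using ord_nonzero by simp
  qed
  finally show ?thesis by simp
qed

text \<open>
  Since \<open>average - 1 = (T - 1) q = (b B + B b) q\<close> and \<open>q\<close> commutes with \<open>b\<close>, the homotopy is \<open>B q\<close>.
\<close>

definition homotopy :: "('k, 'a, 'a) free_chain \<Rightarrow> ('k, 'a, 'a) free_chain" where
  "homotopy x = connes (average_quotient x)"

lemma linear_average: "Vector_Spaces.linear fscale fscale average"
  and average_C: "x \<in> C n \<Longrightarrow> average x \<in> C n"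
  and average_R: "r \<in> R n \<Longrightarrow> average r \<in> R n"
  and bnd_average: "x \<in> C n \<Longrightarrow> bnd (average x) = average (bnd x)"
  and average_T: "average (T x) = T (average x)"
  using natural_average by (auto simp: natural_operator_def)

lemma linear_homotopy: "Vector_Spaces.linear fscale fscale homotopy"
  unfolding homotopy_def[abs_def]
  using natural_average_quotient by (intro linear_map_compose[OF _ linear_lin_ext]) (simp add: natural_operator_def)

lemma homotopy_C: "x \<in> C n \<Longrightarrow> homotopy x \<in> C (Suc n)"
  and homotopy_R: "r \<in> R n \<Longrightarrow> homotopy r \<in> R (Suc n)"
  using natural_average_quotient by (auto simp: natural_operator_def homotopy_def connes_C connes_R)

lemma average_homotopy:
  assumes "x \<in> C n" shows "average x - x = bnd (homotopy x) + homotopy (bnd x)"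
proof -
  have "average_quotient x \<in> C n" "bnd (average_quotient x) = average_quotient (bnd x)"
    using natural_average_quotient assms by (auto simp: natural_operator_def)
  with connes_homotopy[of "average_quotient x" n] show ?thesis
    by (simp add: average_minus_id homotopy_def)
qed

lemma average_relation:
  assumes "T x - x \<in> R n" shows "average x - x \<in> R n"
proof -
  have lin: "Vector_Spaces.linear fscale fscale average_quotient"
    and comm: "average_quotient (T x) = T (average_quotient x)"
    using natural_average_quotient unfolding natural_operator_def by blast+
  have "average_quotient (T x - x) = average x - x"
    unfolding linear_map_diff[OF lin] comm average_minus_id ..
  then show ?thesis
    using natural_average_quotient assms unfolding natural_operator_def by metis
qed

text \<open>
  The transpose of \<open>average\<close> fixes the functionals that are fixed by the transpose of \<open>T\<close>.
\<close>

lemma functional_average: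
  assumes "Vector_Spaces.linear fscale (*) \<psi>" "\<And>x. x \<in> C n \<Longrightarrow> \<psi> (T x) = \<psi> x" "x \<in> C n"
  shows "\<psi> (average x) = \<psi> x"
proof -
  have "average_quotient x \<in> C n"
    using natural_average_quotient assms(3) by (auto simp: natural_operator_def)
  then have "\<psi> (average x - x) = 0"
    by (simp add: average_minus_id linear_map_diff[OF assms(1)] assms(2))
  then show ?thesis
    by (simp add: linear_map_diff[OF assms(1)])
qed

end

section \<open>Cochains as functionals on chains\<close>

context nakayama_algebra
begin

text \<open>
  The Riesz property of a non-degenerate form in finite dimension. To avoid dimension counts for the dual
  space, the values of a functional on a basis \<open>E\<close> serve as the coordinates of a vector of \<open>A\<close>;
  \<open>a \<mapsto> form a\<close> then becomes an endomorphism \<open>L\<close> of \<open>A\<close>, and injective implies surjective.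
\<close>

lemma form_representable:
  assumes "Vector_Spaces.linear scale (*) \<psi>"
  obtains v where "\<And>a. form v a = \<psi> a"
proof -
  obtain S where S: "finite S" "span S = UNIV" using finite_dim by blast
  obtain E where E: "E \<subseteq> S" "independent E" "S \<subseteq> span E"
    by (rule maximal_independent_subset)
  have fin: "finite E" using S E finite_subset by blast
  have spE: "span E = UNIV"
    using S E(3) by (metis span_minimal subspace_span top.extremum_uniqueI)
  interpret fd: finite_dimensional_vector_space scale E
    by unfold_locales (use fin E(2) spE in auto)
  have eqI: "\<phi> a = \<phi>' a" if "Vector_Spaces.linear scale (*) \<phi>" "Vector_Spaces.linear scale (*) \<phi>'"
    "\<And>e. e \<in> E \<Longrightarrow> \<phi> e = \<phi>' e" for \<phi> \<phi>' :: "'a \<Rightarrow> 'k" and a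
  proof -
    have "a \<in> span E" by (simp add: spE)
    then show ?thesis
      by (induction rule: span_induct_alt)
        (simp_all add: linear_map_zero[OF that(1)] linear_map_zero[OF that(2)] linear_map_add[OF that(1)]
          linear_map_add[OF that(2)] linear_map_scale[OF that(1)] linear_map_scale[OF that(2)] that(3))
  qed
  define L where "L a = (\<Sum>e\<in>E. scale (form a e) e)" for a
  have coords: "\<forall>e\<in>E. x e = y e" if "(\<Sum>e\<in>E. scale (x e) e) = (\<Sum>e\<in>E. scale (y e) e)" for x y
  proof -
    have "(\<Sum>e\<in>E. scale (x e - y e) e) = 0"
      using that by (simp add: scale_left_diff_distrib sum_subtractf)
    then show ?thesis
      using independentD[OF E(2) fin subset_refl, of "\<lambda>e. x e - y e"] by auto
  qed
  have lin: "Vector_Spaces.linear scale scale L"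
    by (simp add: Vector_Spaces.linear_iff vector_space_axioms L_def form_add_left form_scale_left
        scale_left_distrib sum.distrib scale_sum_right)
  have "inj L"
  proof (rule injI)
    fix a a' assume "L a = L a'"
    then have "\<forall>e\<in>E. form a e = form a' e" unfolding L_def by (rule coords)
    then show "a = a'"
      using eqI[OF form_linear_right form_linear_right] by (intro form_eqI) blast
  qed
  interpret fdp: finite_dimensional_vector_space_pair scale E scale E
    by unfold_locales
  have "surj L" using fdp.linear_injective_imp_surjective[OF lin \<open>inj L\<close> refl] .
  then obtain v where "L v = (\<Sum>e\<in>E. scale (\<psi> e) e)" by (metis surj_def)
  then have "\<forall>e\<in>E. form v e = \<psi> e" unfolding L_def by (rule coords)
  then show thesis
    using eqI[OF form_linear_right assms] that by blast
qed

abbreviation coch :: "nat \<Rightarrow> ('a list \<Rightarrow> 'a) set" where "coch \<equiv> cochains scale (regular_bimodule scale)"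

abbreviation pair :: "('a list \<Rightarrow> 'a) \<Rightarrow> ('k, 'a, 'a) free_chain \<Rightarrow> 'k" where "pair \<equiv> pairing form"

abbreviation cobnd :: "nat \<Rightarrow> ('a list \<Rightarrow> 'a) \<Rightarrow> ('a list \<Rightarrow> 'a)" where
  "cobnd \<equiv> hoch_coboundary (regular_bimodule scale)"

lemma coch_iff: "f \<in> coch n \<longleftrightarrow>
    (\<forall>xs. length xs \<noteq> n \<longrightarrow> f xs = 0) \<and>
    (\<forall>xs ys a b. length xs + length ys + 1 = n \<longrightarrow>
            f (xs @ (a + b) # ys) = f (xs @ a # ys) + f (xs @ b # ys)) \<and>
    (\<forall>xs ys a t. length xs + length ys + 1 = n \<longrightarrow>
            f (xs @ scale t a # ys) = scale t (f (xs @ a # ys)))"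
  by (simp add: cochains_def regular_bimodule_def)

lemma relations:
  shows relation_coeff_add: "length as = n \<Longrightarrow> Poly_Mapping.single (m + m', as) 1 - Poly_Mapping.single (m, as) 1
      - Poly_Mapping.single (m', as) 1 \<in> R n"
    and relation_coeff_scale: "length as = n \<Longrightarrow>
      Poly_Mapping.single (scale t m, as) 1 - Poly_Mapping.single (m, as) t \<in> R n"
    and relation_slot_add: "length as + length bs + 1 = n \<Longrightarrow>
      Poly_Mapping.single (m, as @ (a + a') # bs) 1 - Poly_Mapping.single (m, as @ a # bs) 1
         - Poly_Mapping.single (m, as @ a' # bs) 1 \<in> R n"
    and relation_slot_scale: "length as + length bs + 1 = n \<Longrightarrow>
      Poly_Mapping.single (m, as @ scale t a # bs) 1 - Poly_Mapping.single (m, as @ a # bs) t \<in> R n"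
  unfolding tensor_relations_def twisted_bimodule_def
  by (rule free_space.span_base; simp; blast)+

lemma pairing_relation:
  assumes f: "f \<in> coch n" and "r \<in> R n"
  shows "pair f r = 0"
proof -
  have "Vector_Spaces.linear fscale (*) (pair f)" by simp
  note lin = linear_map_zero[OF this] linear_map_add[OF this] linear_map_diff[OF this] linear_map_scale[OF this]
  have f': "f (xs @ (a + b) # ys) = f (xs @ a # ys) + f (xs @ b # ys)"
      "f (xs @ scale t a # ys) = scale t (f (xs @ a # ys))" if "length xs + length ys + 1 = n" for xs ys a b t
    using f that unfolding coch_iff by blast+
  show ?thesis
    using assms(2) unfolding tensor_relations_def
  proof (induction rule: free_space.span_induct)
    case base
    show ?case by (simp add: free_space.subspace_def lin)
  next
    case (step x)
    then show ?case
      by (auto simp: twisted_bimodule_def lin f' form_add_left form_add_right form_scale_left form_scale_right)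
  qed
qed

lemma cochain_eqI:
  assumes "\<And>as. length as \<noteq> n \<Longrightarrow> f as = 0" "\<And>as. length as \<noteq> n \<Longrightarrow> g as = 0"
    and "\<And>x. x \<in> C n \<Longrightarrow> pair f x = pair g x"
  shows "f = g"
proof
  fix as :: "'a list"
  show "f as = g as"
  proof (cases "length as = n")
    case True
    have "form (f as) a0 = form (g as) a0" for a0
      using assms(3)[OF tensor_in_C[of "as @ [a0]" n 1]] True by simp
    then show ?thesis by (rule form_eqI)
  qed (simp add: assms)
qed

text \<open>
  Together with \<open>pairing_relation\<close> and \<open>cochain_eqI\<close>, this identifies cochains with the functionals on
  chains that kill the tensor relations, so that facts about chains can be transposed.
\<close>

lemma cochain_of_functional:
  assumes \<psi>: "Vector_Spaces.linear fscale (*) \<psi>" and R: "\<And>r. r \<in> R n \<Longrightarrow> \<psi> r = 0"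
  obtains f where "f \<in> coch n" "\<And>x. x \<in> C n \<Longrightarrow> pair f x = \<psi> x"
proof -
  have rel_add: "\<psi> x = \<psi> y + \<psi> z" if "x - y - z \<in> R n" for x y z
    using R[OF that] by (simp add: linear_map_diff[OF \<psi>] diff_eq_eq add.commute)
  have rel_scale: "\<psi> x = c * \<psi> (Poly_Mapping.single t 1)" if "x - Poly_Mapping.single t c \<in> R n" for x t c
    using R[OF that] linear_map_scale[OF \<psi>, of c "Poly_Mapping.single t 1"] by (simp add: linear_map_diff[OF \<psi>])
  have "\<exists>v. \<forall>a0. form v a0 = \<psi> (Poly_Mapping.single (a0, as) 1)" if "length as = n" for as
  proof -
    have "Vector_Spaces.linear scale (*) (\<lambda>a0. \<psi> (Poly_Mapping.single (a0, as) 1))"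
      by (simp add: Vector_Spaces.linear_iff vector_space_axioms field_space.vector_space_axioms
          rel_add[OF relation_coeff_add[OF that]] rel_scale[OF relation_coeff_scale[OF that]])
    then show ?thesis by (rule form_representable) blast
  qed
  then obtain f0 where f0: "\<And>as a0. length as = n \<Longrightarrow> form (f0 as) a0 = \<psi> (Poly_Mapping.single (a0, as) 1)"
    by metis
  define f where "f as = (if length as = n then f0 as else 0)" for as
  have f: "form (f as) a0 = \<psi> (Poly_Mapping.single (a0, as) 1)" if "length as = n" for as a0
    using f0 that by (simp add: f_def)
  show thesis
  proof
    show "f \<in> coch n"
      unfolding coch_iff
    proof (intro conjI allI impI)
      fix xs ys :: "'a list" and a b t assume l: "length xs + length ys + 1 = n"
      show "f (xs @ (a + b) # ys) = f (xs @ a # ys) + f (xs @ b # ys)"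
        using l by (intro form_eqI) (simp add: f form_add_left rel_add[OF relation_slot_add[OF l]])
      show "f (xs @ scale t a # ys) = scale t (f (xs @ a # ys))"
        using l by (intro form_eqI) (simp add: f form_scale_left rel_scale[OF relation_slot_scale[OF l]])
    qed (simp add: f_def)
    show "pair f x = \<psi> x" if "x \<in> C n" for x
      by (rule linear_eq_on_C[OF linear_pairing \<psi> that]) (auto simp: tensor_def f)
  qed
qed

lemma cochain_pullback:
  assumes f: "f \<in> coch n" and F: "Vector_Spaces.linear fscale fscale F" and R: "\<And>r. r \<in> R n' \<Longrightarrow> F r \<in> R n"
  obtains f' where "f' \<in> coch n'" "\<And>x. x \<in> C n' \<Longrightarrow> pair f' x = pair f (F x)"
  using cochain_of_functional[OF linear_map_compose[OF F linear_pairing]] pairing_relation[OF f R] by blast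

text \<open>
  The left action on values is moved to the other argument of the form by
  \<open>\<langle>a x, c\<rangle> = \<langle>x c, N a\<rangle> = \<langle>x, c N(a)\<rangle>\<close>, which is the right action of \<open>A\<^sub>N\<close> on the coefficient \<open>c\<close>.
\<close>

lemma pairing_coboundary:
  assumes "x \<in> C (Suc n)"
  shows "pair (cobnd n f) x = pair f (bnd x)"
proof (rule linear_eq_on_C[OF linear_pairing linear_map_compose[OF linear_lin_ext linear_pairing] assms])
  fix w :: "'a list" assume "length w = Suc (Suc n)"
  then obtain as a0 where w: "w = as @ [a0]" and as: "length as = Suc n"
    by (metis length_append_singleton rev_exhaust length_0_conv nat.distinct(1) Suc_inject)
  then have "as \<noteq> []" by auto
  have "form (hd as * f (tl as)) a0 = form (f (tl as)) (a0 * N (hd as))"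
    by (simp add: form_assoc form_N[of "hd as"])
  moreover have "form (\<Sum>i<n. scale (- ((- 1) ^ i)) (f (mult_at i as))) a0 =
      (\<Sum>i<n. - ((- 1) ^ i) * form (f (mult_at i as)) a0)"
    using linear_map_sum[OF form_linear_left, of "\<lambda>i. scale (- ((- 1) ^ i)) (f (mult_at i as))" "{..<n}" a0]
    by (simp only: form_scale_left)
  ultimately show "pair (cobnd n f) (Poly_Mapping.single (tensor w) 1) = pair f (bnd (Poly_Mapping.single (tensor w) 1))"
    using as \<open>as \<noteq> []\<close>
    by (simp add: w hoch_coboundary_def hoch_boundary_pure_def regular_bimodule_def twisted_bimodule_def
        linear_map_add[OF linear_pairing] linear_map_sum[OF linear_pairing] linear_map_neg[OF linear_pairing]
        form_add_left form_diff_left form_scale_left form_assoc)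
qed

lemma coboundary_cochain:
  assumes "f \<in> coch n" shows "cobnd n f \<in> coch (Suc n)"
proof -
  obtain f' where f': "f' \<in> coch (Suc n)" "\<And>x. x \<in> C (Suc n) \<Longrightarrow> pair f' x = pair f (bnd x)"
    using cochain_pullback[OF assms linear_lin_ext bnd_R] by blast
  then have "cobnd n f = f'"
    by (intro cochain_eqI[of "Suc n"]) (simp_all add: pairing_coboundary hoch_coboundary_def coch_iff)
  with f' show ?thesis by simp
qed

text \<open>
  Volkov's sum is, by definition, the pairing of \<open>f\<close> with \<open>B\<close> of a basis chain; as \<open>B\<close> respects the tensor
  relations, it is linear in \<open>a\<^sub>0\<close>, and the value that it is supposed to define exists.
\<close>

lemma volkov_cochain:
  assumes f: "f \<in> coch (Suc n)"
  shows form_volkov_cochain: "form (volkov_cochain form N f as) a0 =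
      (\<Sum>i\<le>length as. (-1) ^ (i * length as) * form (f (twisted_rotation N i a0 as)) 1)"
    and volkov_cochain_in_coch: "volkov_cochain form N f \<in> coch n"
    and pairing_volkov_cochain: "x \<in> C n \<Longrightarrow> pair (volkov_cochain form N f) x = pair f (connes x)"
proof -
  obtain g where g: "g \<in> coch n" "\<And>x. x \<in> C n \<Longrightarrow> pair g x = pair f (connes x)"
    using cochain_pullback[OF f linear_lin_ext connes_R] by blast
  have formula: "form (g as) a0 =
      (\<Sum>i\<le>length as. (-1) ^ (i * length as) * form (f (twisted_rotation N i a0 as)) 1)" for as a0
  proof (cases "length as = n")
    case True
    then have "form (g as) a0 = pair f (connes_pure N (a0, as))"
      using g(2)[OF tensor_in_C[of "as @ [a0]" n 1]] by simp
    then show ?thesis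
      by (simp add: connes_pure_def linear_map_sum[OF linear_pairing])
  next
    case False
    have "length (twisted_rotation N i a0 as) = Suc (length as)" if "i \<le> length as" for i
      using that by (auto simp: twisted_rotation_def)
    with False f g(1) show ?thesis
      using linear_map_zero[OF form_linear_left] by (simp add: coch_iff)
  qed
  have "volkov_cochain form N f as = g as" for as
    unfolding volkov_cochain_def formula[symmetric] by (intro the_equality) (auto intro: form_eqI)
  then have "volkov_cochain form N f = g" by blast
  with g formula show "volkov_cochain form N f \<in> coch n"
      "x \<in> C n \<Longrightarrow> pair (volkov_cochain form N f) x = pair f (connes x)"
      "form (volkov_cochain form N f as) a0 =
        (\<Sum>i\<le>length as. (-1) ^ (i * length as) * form (f (twisted_rotation N i a0 as)) 1)"
    by simp_all
qed

end

section \<open>Classes and induced maps\<close>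

definition additive_subgroup :: "'v::ab_group_add set \<Rightarrow> bool" where
  "additive_subgroup B \<longleftrightarrow> 0 \<in> B \<and> (\<forall>x\<in>B. \<forall>y\<in>B. x - y \<in> B)"

lemma mem_coset: "y \<in> coset B x \<longleftrightarrow> y - x \<in> B"
  by (auto simp: coset_def) (metis add.commute diff_add_cancel)

lemma additive_subgroup_uminus: "additive_subgroup B \<Longrightarrow> x \<in> B \<Longrightarrow> - x \<in> B"
  unfolding additive_subgroup_def by (metis diff_0)

lemma additive_subgroup_add: "additive_subgroup B \<Longrightarrow> x \<in> B \<Longrightarrow> y \<in> B \<Longrightarrow> x + y \<in> B"
  using additive_subgroup_uminus[of B y] unfolding additive_subgroup_def by fastforce

lemma coset_self: "additive_subgroup B \<Longrightarrow> x \<in> coset B x"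
  by (simp add: mem_coset additive_subgroup_def)

lemma coset_eqI:
  assumes B: "additive_subgroup B" and "y - x \<in> B"
  shows "coset B y = coset B x"
proof -
  have "z - y \<in> B \<longleftrightarrow> z - x \<in> B" for z
  proof
    assume "z - y \<in> B"
    then have "(z - y) + (y - x) \<in> B" using assms(2) by (rule additive_subgroup_add[OF B])
    then show "z - x \<in> B" by simp
  next
    assume "z - x \<in> B"
    then have "(z - x) - (y - x) \<in> B" using assms by (simp only: additive_subgroup_def)
    then show "z - y \<in> B" by simp
  qed
  then show ?thesis by (auto simp: mem_coset)
qed

text \<open>
  A single representative in \<open>I\<close> pins down the target class, since distinct classes are disjoint.
\<close>

lemma induced_map_eq:
  assumes B: "additive_subgroup B" and H: "H = coset B ` S" and d: "d \<in> H"
    and x: "x \<in> c" "x \<in> I" and F: "F ` (c \<inter> I) \<subseteq> d"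
  shows "induced_map F I H c = d"
  unfolding induced_map_def
proof (rule the_equality)
  have eq: "e = coset B (F x)" if "e \<in> H" "F x \<in> e" for e
    using that coset_eqI[OF B] by (auto simp: H mem_coset)
  show "e = d" if "e \<in> H \<and> F ` (c \<inter> I) \<subseteq> e" for e
    using eq[of e] eq[of d] that d x F by blast
qed (use d F in blast)

section \<open>Duality between cohomology and homology\<close>

context nakayama_algebra
begin

abbreviation cyc :: "nat \<Rightarrow> ('k, 'a, 'a) free_chain set" where "cyc \<equiv> cycles scale M"

abbreviation bdr :: "nat \<Rightarrow> ('k, 'a, 'a) free_chain set" where "bdr \<equiv> boundaries scale M"

abbreviation cocyc :: "nat \<Rightarrow> ('a list \<Rightarrow> 'a) set" where "cocyc \<equiv> cocycles scale (regular_bimodule scale)"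

abbreviation cobdr :: "nat \<Rightarrow> ('a list \<Rightarrow> 'a) set" where "cobdr \<equiv> coboundaries scale (regular_bimodule scale)"

text \<open>
  In degree \<open>0\<close> the truncated \<open>n - 1\<close> is harmless: \<open>b\<close> vanishes there.
\<close>

lemma cyc_iff: "x \<in> cyc n \<longleftrightarrow> x \<in> C n \<and> bnd x \<in> R (n - 1)"
  using free_space.subspace_0[OF subspace_R]
  by (cases n) (auto simp: cycles_def bnd_C_0)

lemma subspace_cyc: "free_space.subspace (cyc n)"
  unfolding free_space.subspace_def
  by (auto simp: cyc_iff linear_map_zero[OF linear_lin_ext] linear_map_add[OF linear_lin_ext]
      linear_map_scale[OF linear_lin_ext] free_space.subspace_0[OF subspace_R] free_space.subspace_0[OF subspace_C]
      free_space.subspace_add[OF subspace_R] free_space.subspace_add[OF subspace_C]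
      free_space.subspace_scale[OF subspace_R] free_space.subspace_scale[OF subspace_C])

lemma bdr_iff: "x \<in> bdr n \<longleftrightarrow> (\<exists>r\<in>R n. \<exists>y\<in>C (Suc n). x = r + bnd y)"
  by (auto simp: boundaries_def)

lemma relation_in_bdr: "r \<in> R n \<Longrightarrow> r \<in> bdr n"
  unfolding bdr_iff using free_space.subspace_0[OF subspace_C]
  by (intro bexI[of _ r] bexI[of _ 0]) (simp_all add: linear_map_zero[OF linear_lin_ext])

lemma bnd_in_bdr: "y \<in> C (Suc n) \<Longrightarrow> bnd y \<in> bdr n"
  unfolding bdr_iff using free_space.subspace_0[OF subspace_R]
  by (intro bexI[of _ 0] bexI[of _ y]) simp_all

lemma bdr_subgroup: "additive_subgroup (bdr n)"
  unfolding additive_subgroup_def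
proof (intro conjI ballI)
  show "0 \<in> bdr n" by (rule relation_in_bdr[OF free_space.subspace_0[OF subspace_R]])
  fix x y assume "x \<in> bdr n" "y \<in> bdr n"
  then obtain r r' z z' where "r \<in> R n" "r' \<in> R n" "z \<in> C (Suc n)" "z' \<in> C (Suc n)"
      "x = r + bnd z" "y = r' + bnd z'"
    unfolding bdr_iff by blast
  then show "x - y \<in> bdr n"
    unfolding bdr_iff
    by (intro bexI[of _ "r - r'"] bexI[of _ "z - z'"])
      (simp_all add: linear_map_diff[OF linear_lin_ext] free_space.subspace_diff[OF subspace_R]
        free_space.subspace_diff[OF subspace_C])
qed

lemma pairing_diff_cochain: "pair (f - g) x = pair f x - pair g x"
  by (rule linear_eq_on_keys[OF linear_pairing linear_map_pointwise_diff[OF linear_pairing linear_pairing]])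
    (auto simp: form_diff_left)

lemma pairing_0: "pair 0 x = 0"
  using pairing_diff_cochain[of 0 0 x] by simp

lemma zero_in_coch: "0 \<in> coch n"
  by (simp add: coch_iff)

lemma diff_in_coch: "f \<in> coch n \<Longrightarrow> g \<in> coch n \<Longrightarrow> f - g \<in> coch n"
  by (simp add: coch_iff scale_right_diff_distrib)

lemma cochain_eq_0_iff:
  assumes "f \<in> coch n" shows "f = 0 \<longleftrightarrow> (\<forall>x\<in>C n. pair f x = 0)"
  using assms cochain_eqI[of n f 0] by (auto simp: pairing_0 coch_iff)

lemma cocycle_iff: "f \<in> cocyc n \<longleftrightarrow> f \<in> coch n \<and> (\<forall>x\<in>C (Suc n). pair f (bnd x) = 0)"
  using cochain_eq_0_iff[OF coboundary_cochain] by (auto simp: cocycles_def pairing_coboundary)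

text \<open>
  A cochain that vanishes on cycles is, as a functional, of the form \<open>\<psi> \<circ> b\<close> by \<open>factor_functional\<close>, and \<open>\<psi>\<close> is
  given by a cochain of one degree less. From here on, being a coboundary is a condition
  that can be tested against cycles, without exhibiting a primitive.
\<close>

lemma coboundary_iff: "f \<in> cobdr n \<longleftrightarrow> f \<in> coch n \<and> (\<forall>x\<in>cyc n. pair f x = 0)"
proof (cases n)
  case 0
  have "f \<in> cobdr 0 \<longleftrightarrow> f = 0" by (simp add: coboundaries_def)
  also have "\<dots> \<longleftrightarrow> f \<in> coch 0 \<and> (\<forall>x\<in>C 0. pair f x = 0)"
    using cochain_eq_0_iff[of f 0] zero_in_coch[of 0] by blast
  finally show ?thesis by (simp add: 0 cycles_def)
next
  case (Suc m)
  show ?thesis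
  proof
    assume "f \<in> cobdr n"
    then obtain g where g: "g \<in> coch m" "f = cobnd m g" by (auto simp: Suc coboundaries_def)
    then show "f \<in> coch n \<and> (\<forall>x\<in>cyc n. pair f x = 0)"
      using coboundary_cochain pairing_relation[of g m] by (auto simp: Suc cyc_iff pairing_coboundary)
  next
    assume f: "f \<in> coch n \<and> (\<forall>x\<in>cyc n. pair f x = 0)"
    obtain \<psi> where \<psi>: "Vector_Spaces.linear fscale (*) \<psi>" "\<And>r. r \<in> R m \<Longrightarrow> \<psi> r = 0"
        "\<And>x. x \<in> C n \<Longrightarrow> \<psi> (bnd x) = pair f x"
      by (rule factor_functional[OF linear_lin_ext linear_pairing subspace_C[of n] subspace_R[of m],
            of "hoch_boundary_pure M" form f])
        (use f in \<open>auto simp: cyc_iff Suc\<close>)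
    obtain g where g: "g \<in> coch m" "\<And>x. x \<in> C m \<Longrightarrow> pair g x = \<psi> x"
      using cochain_of_functional[OF \<psi>(1,2)] by blast
    have "cobnd m g = f"
      using coboundary_cochain[OF g(1)] f
      by (intro cochain_eqI[of n]) (auto simp: Suc coch_iff pairing_coboundary g(2) bnd_C \<psi>(3))
    with g show "f \<in> cobdr n" by (auto simp: Suc coboundaries_def)
  qed
qed

lemma cobdr_subgroup: "additive_subgroup (cobdr n)"
  by (simp add: additive_subgroup_def coboundary_iff zero_in_coch diff_in_coch pairing_0 pairing_diff_cochain)

lemma bnd_in_cyc: "y \<in> C (Suc n) \<Longrightarrow> bnd y \<in> cyc n"
  using bnd_bnd[of y "Suc n"] free_space.subspace_0[OF subspace_R] by (simp add: cyc_iff bnd_C)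

lemma cobdr_subset_cocyc: "f \<in> cobdr n \<Longrightarrow> f \<in> cocyc n"
  by (simp add: coboundary_iff cocycle_iff bnd_in_cyc)

lemma cocyc_diff: "f \<in> cocyc n \<Longrightarrow> g \<in> cocyc n \<Longrightarrow> f - g \<in> cocyc n"
  by (simp add: cocycle_iff diff_in_coch pairing_diff_cochain)

lemma relation_in_cyc: "r \<in> R n \<Longrightarrow> r \<in> C n \<Longrightarrow> r \<in> cyc n"
  using bnd_R[of r "n - 1"] free_space.subspace_0[OF subspace_R]
  by (cases n) (auto simp: cyc_iff bnd_C_0)

lemma relation_in_C: "r \<in> R n \<Longrightarrow> r \<in> C n"
proof -
  have "R n \<subseteq> C n"
    unfolding tensor_relations_eq
    by (rule free_space.span_minimal[OF _ subspace_C])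
      (auto simp: slot_relations_def intro!: free_space.subspace_diff[OF subspace_C] tensor_in_C)
  then show "r \<in> R n \<Longrightarrow> r \<in> C n" by blast
qed

lemma coset_cocycle:
  assumes "f \<in> coset (cobdr n) f0" "f0 \<in> cocyc n" shows "f \<in> cocyc n"
proof -
  have "f - f0 \<in> cocyc n" using assms cobdr_subset_cocyc by (simp add: mem_coset)
  moreover have "0 - f0 \<in> cocyc n"
    by (rule cocyc_diff[OF _ assms(2)]) (simp add: cocycle_iff zero_in_coch pairing_0)
  ultimately have "(f - f0) - (0 - f0) \<in> cocyc n" by (rule cocyc_diff)
  then show ?thesis by simp
qed

lemma pairing_cosets:
  assumes f0: "f0 \<in> cocyc n" and x0: "x0 \<in> cyc n" and f: "f \<in> coset (cobdr n) f0" and x: "x \<in> coset (bdr n) x0"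
  shows "pair f x = pair f0 x0"
proof -
  obtain r y where r: "r \<in> R n" "y \<in> C (Suc n)" "x - x0 = r + bnd y"
    using x unfolding mem_coset bdr_iff by blast
  then have "x - x0 \<in> cyc n"
    by (simp add: free_space.subspace_add[OF subspace_cyc] relation_in_cyc relation_in_C bnd_in_cyc)
  then have "x \<in> cyc n"
    using free_space.subspace_add[OF subspace_cyc x0, of "x - x0"] by simp
  then have "pair f x = pair f0 x"
    using f unfolding mem_coset coboundary_iff pairing_diff_cochain by simp
  moreover have "pair f0 (x - x0) = 0"
    using r f0 pairing_relation[of f0 n] by (simp add: cocycle_iff linear_map_add[OF linear_pairing])
  ultimately show ?thesis by (simp add: linear_map_diff[OF linear_pairing])
qed

lemma del_inv_eq:
  assumes "f \<in> cocyc n" "x \<in> cyc n"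
  shows "del_inv scale form N n (coset (cobdr n) f) (coset (bdr n) x) = pair f x"
proof -
  have "coset (bdr n) x \<in> hoch_homology scale M n"
    using assms by (auto simp: hoch_homology_def)
  moreover have "(THE v. \<forall>f'\<in>coset (cobdr n) f. \<forall>x'\<in>coset (bdr n) x. pair f' x' = v) = pair f x"
    using pairing_cosets[OF assms] coset_self[OF cobdr_subgroup, of f n] coset_self[OF bdr_subgroup, of x n]
    by (intro the_equality) metis+
  ultimately show ?thesis by (simp add: del_inv_def)
qed

lemma HH_E:
  assumes "c \<in> HH scale n" obtains f where "f \<in> cocyc n" "c = coset (cobdr n) f"
  using assms by (auto simp: hoch_cohomology_def)

lemma del_inv_in_dual:
  assumes "c \<in> HH scale n"
  shows "del_inv scale form N n c \<in> hoch_homology_dual scale M n"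
proof -
  obtain f where f: "f \<in> cocyc n" "c = coset (cobdr n) f" by (rule HH_E[OF assms])
  have "del_inv scale form N n c \<in> extensional (hoch_homology scale M n)"
    by (simp add: del_inv_def)
  then show ?thesis
    using f free_space.subspace_add[OF subspace_cyc] free_space.subspace_scale[OF subspace_cyc]
    by (simp add: hoch_homology_dual_def del_inv_eq linear_map_add[OF linear_pairing] linear_map_scale[OF linear_pairing])
qed

text \<open>
  The difference of two cocycles with the same image vanishes on cycles, hence is a coboundary.
\<close>

lemma inj_del_inv: "inj_on (del_inv scale form N n) (HH scale n)"
proof (rule inj_onI)
  fix c c' assume "c \<in> HH scale n" "c' \<in> HH scale n"
    and eq: "del_inv scale form N n c = del_inv scale form N n c'"
  then obtain f f' where f: "f \<in> cocyc n" "c = coset (cobdr n) f" "f' \<in> cocyc n" "c' = coset (cobdr n) f'"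
    by (metis HH_E)
  have "pair f x = pair f' x" if "x \<in> cyc n" for x
    using fun_cong[OF eq, of "coset (bdr n) x"] f that by (simp add: del_inv_eq)
  then have "f - f' \<in> cobdr n"
    using f by (simp add: coboundary_iff cocycle_iff diff_in_coch pairing_diff_cochain)
  then show "c = c'"
    using f coset_eqI[OF cobdr_subgroup] by simp
qed

end

section \<open>The isomorphism with cohomology of the twisted dual\<close>

lemma sum_fun_apply: "(\<Sum>i\<in>I. g i) x = (\<Sum>i\<in>I. g i x)" for g :: "'i \<Rightarrow> 'x \<Rightarrow> 'v::comm_monoid_add"
  by (induction I rule: infinite_finite_induct) simp_all

context nakayama_algebra
begin

abbreviation Md :: "('k, 'a, 'a \<Rightarrow> 'k) bimodule" where "Md \<equiv> twisted_dual_bimodule scale N"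

abbreviation Z_map :: "('a list \<Rightarrow> 'a) \<Rightarrow> ('a list \<Rightarrow> 'a \<Rightarrow> 'k)" where "Z_map \<equiv> (\<lambda>f as. form (f as))"

lemma form_0_left: "form 0 = 0"
  using linear_map_zero[OF form_linear_left] by (simp add: fun_eq_iff)

lemma form_inj: "form a = form b \<longleftrightarrow> a = b"
  using form_eqI by metis

lemma inj_ZZ: "inj Z_map"
  by (auto simp: inj_def fun_eq_iff intro: form_eqI)

lemma Z_map_diff: "Z_map (f - g) = Z_map f - Z_map g"
  by (simp add: fun_eq_iff form_diff_left)

text \<open>
  Surjectivity is the Riesz property, applied to each value of a cochain.
\<close>

lemma Z_map_cochains: "Z_map ` coch n = cochains scale Md n"
proof -
  have iff: "Z_map f \<in> cochains scale Md n \<longleftrightarrow> f \<in> coch n" for f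
  proof -
    have "form (f (xs @ (a + b) # ys)) = form (f (xs @ a # ys)) + form (f (xs @ b # ys)) \<longleftrightarrow>
        f (xs @ (a + b) # ys) = f (xs @ a # ys) + f (xs @ b # ys)" for xs ys a b
      by (simp add: form_add_left fun_eq_iff flip: form_inj)
    moreover have "form (f (xs @ scale t a # ys)) = (\<lambda>c. t * form (f (xs @ a # ys)) c) \<longleftrightarrow>
        f (xs @ scale t a # ys) = scale t (f (xs @ a # ys))" for xs ys a t
      by (simp add: form_scale_left fun_eq_iff flip: form_inj)
    moreover have "form a = 0 \<longleftrightarrow> a = 0" for a
      by (metis form_0_left form_inj)
    ultimately show ?thesis
      by (simp add: cochains_def twisted_dual_bimodule_def regular_bimodule_def form_linear_right)
  qed
  moreover have "\<exists>f. g = Z_map f" if g: "g \<in> cochains scale Md n" for g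
  proof -
    have "\<exists>v. g as = form v" for as
    proof (cases "length as = n")
      case True
      then have "Vector_Spaces.linear scale (*) (g as)"
        using g by (simp add: cochains_def twisted_dual_bimodule_def)
      then show ?thesis using form_representable[of "g as"] by (metis ext)
    next
      case False
      then have "g as = form 0" using g by (simp add: cochains_def form_0_left)
      then show ?thesis by blast
    qed
    then show ?thesis by (metis ext)
  qed
  ultimately show ?thesis by blast
qed

lemma Z_map_coboundary: "hoch_coboundary Md n (Z_map f) = Z_map (cobnd n f)"
proof (intro ext)
  fix as a0
  have sum: "form (\<Sum>i<n. scale ((- 1) ^ Suc i) (f (mult_at i as))) a0 =
      (\<Sum>i<n. (- 1) ^ Suc i * form (f (mult_at i as)) a0)"
    using linear_map_sum[OF form_linear_left, of "\<lambda>i. scale ((- 1) ^ Suc i) (f (mult_at i as))" "{..<n}" a0]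
    by (simp only: form_scale_left)
  have "form (hd as * f (tl as)) a0 = form (f (tl as)) (a0 * N (hd as))"
    by (simp add: form_assoc form_N[of "hd as"])
  then show "hoch_coboundary Md n (Z_map f) as a0 = Z_map (cobnd n f) as a0"
    by (simp add: hoch_coboundary_def twisted_dual_bimodule_def regular_bimodule_def form_0_left
        form_add_left form_scale_left form_assoc sum sum_fun_apply del: power_Suc)
qed

lemma Z_map_cocycles: "Z_map ` cocyc n = cocycles scale Md n"
proof -
  have "Z_map g = 0 \<longleftrightarrow> g = 0" for g
    by (auto simp: fun_eq_iff form_0_left intro: form_nondegenerate_left)
  then show ?thesis
    by (auto simp: cocycles_def Z_map_coboundary zero_fun_def simp flip: Z_map_cochains)
qed

lemma Z_map_coboundaries: "Z_map ` cobdr n = coboundaries scale Md n"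
proof (cases n)
  case 0
  then show ?thesis by (simp add: coboundaries_def form_0_left zero_fun_def)
next
  case (Suc m)
  then show ?thesis
    by (simp add: coboundaries_def Z_map_coboundary image_image flip: Z_map_cochains)
qed

lemma Z_map_add: "Z_map (f + g) = Z_map f + Z_map g"
  by (simp add: fun_eq_iff form_add_left)

lemma Z_map_coset: "Z_map ` coset (cobdr n) f = coset (coboundaries scale Md n) (Z_map f)"
  unfolding coset_def Setcompr_eq_image Z_map_coboundaries[symmetric] image_image Z_map_add ..

lemma dual_coboundaries_subgroup: "additive_subgroup (coboundaries scale Md n)"
  unfolding additive_subgroup_def Z_map_coboundaries[symmetric]
proof (intro conjI ballI)
  have "Z_map 0 \<in> Z_map ` cobdr n"
    using cobdr_subgroup[of n] by (intro imageI[of 0 _ Z_map]) (simp add: additive_subgroup_def)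
  then show "0 \<in> Z_map ` cobdr n" by (simp add: form_0_left zero_fun_def)
  fix x y assume "x \<in> Z_map ` cobdr n" "y \<in> Z_map ` cobdr n"
  then obtain f g where "f \<in> cobdr n" "g \<in> cobdr n" "x = Z_map f" "y = Z_map g" by blast
  then have "x - y = Z_map (f - g)" "f - g \<in> cobdr n"
    using cobdr_subgroup[of n] by (simp_all only: Z_map_diff additive_subgroup_def)
  then show "x - y \<in> Z_map ` cobdr n" by blast
qed

lemma Z_map_HH: "(`) Z_map ` HH scale n = hoch_cohomology scale Md n"
  unfolding hoch_cohomology_def Z_map_cocycles[symmetric] by (simp add: image_image Z_map_coset)

lemma Z_star_eq:
  assumes "c \<in> HH scale n" shows "Z_star scale form N n c = Z_map ` c"
proof -
  obtain f where f: "f \<in> cocyc n" "c = coset (cobdr n) f" by (rule HH_E[OF assms])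
  show ?thesis
    unfolding Z_star_def
    by (rule induced_map_eq[OF dual_coboundaries_subgroup hoch_cohomology_def, of _ _ f])
      (use f assms coset_self[OF cobdr_subgroup] in \<open>auto simp flip: Z_map_HH\<close>)
qed

lemma Z_star_inv_eq:
  assumes "c \<in> HH scale n" shows "Z_star_inv scale form N n (Z_map ` c) = c"
proof -
  have inj: "inj_on (Z_star scale form N n) (HH scale n)"
  proof (rule inj_onI)
    fix c c' assume "c \<in> HH scale n" "c' \<in> HH scale n" "Z_star scale form N n c = Z_star scale form N n c'"
    then have "Z_map ` c = Z_map ` c'" by (simp only: Z_star_eq)
    then show "c = c'" by (simp only: inj_image_eq_iff[OF inj_ZZ])
  qed
  show ?thesis
    unfolding Z_star_inv_def Z_star_eq[OF assms, symmetric] by (rule inv_into_f_f[OF inj assms])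
qed

end

section \<open>The operators on classes\<close>

context averaging_algebra
begin

definition equivariant :: "('a list \<Rightarrow> 'a) \<Rightarrow> bool" where
  "equivariant f \<longleftrightarrow> (\<forall>as. f (map N as) = N (f as))"

lemma equivariant_iff:
  assumes "f \<in> coch n"
  shows "equivariant f \<longleftrightarrow> (\<forall>x\<in>C n. pair f (T x) = pair f x)"
proof
  assume f: "equivariant f"
  show "\<forall>x\<in>C n. pair f (T x) = pair f x"
  proof
    fix x assume "x \<in> C n"
    then show "pair f (T x) = pair f x"
      by (rule linear_eq_on_C[OF linear_map_compose[OF linear_lin_ext linear_pairing] linear_pairing])
        (use f in \<open>simp add: tensor_def equivariant_def form_N_N\<close>)
  qed
next
  assume inv: "\<forall>x\<in>C n. pair f (T x) = pair f x"
  show "equivariant f"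
    unfolding equivariant_def
  proof
    fix as
    show "f (map N as) = N (f as)"
    proof (cases "length as = n")
      case True
      have "form (f (map N as)) (N a0) = form (N (f as)) (N a0)" for a0
        using inv tensor_in_C[of "as @ [a0]" n 1] True by (fastforce simp: form_N_N)
      then show ?thesis
        using bij_N by (intro form_eqI) (metis bij_is_surj surj_def)
    next
      case False
      then show ?thesis
        using assms by (simp add: coch_iff linear_map_zero[OF linear_N])
    qed
  qed
qed

lemma cyc_bnd:
  assumes "x \<in> cyc n"
  shows connes_bnd_R: "connes (bnd x) \<in> R n" and homotopy_bnd_R: "homotopy (bnd x) \<in> R n"
proof -
  have "bnd x = 0 \<and> n = 0 \<or> (\<exists>m. n = Suc m \<and> bnd x \<in> R m)"
    using assms by (cases n) (auto simp: cyc_iff bnd_C_0)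
  then show "connes (bnd x) \<in> R n" "homotopy (bnd x) \<in> R n"
    using free_space.subspace_0[OF subspace_R] connes_R homotopy_R linear_map_zero[OF linear_homotopy]
    by (auto simp: linear_map_zero[OF linear_lin_ext])
qed

lemma average_cyc: "x \<in> cyc n \<Longrightarrow> average x \<in> cyc n"
  by (auto simp: cyc_iff average_C bnd_average[of x n] average_R)

lemma average_homologous:
  assumes "x \<in> cyc n" shows "average x - x \<in> bdr n"
proof -
  have x: "x \<in> C n" using assms by (simp add: cyc_iff)
  show ?thesis
    unfolding average_homotopy[OF x]
    by (intro additive_subgroup_add[OF bdr_subgroup] bnd_in_bdr relation_in_bdr homotopy_bnd_R[OF assms] homotopy_C x)
qed

lemma connes_cyc:
  assumes "x \<in> cyc n" "T x - x \<in> R n" shows "connes x \<in> cyc (Suc n)"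
proof -
  have x: "x \<in> C n" using assms(1) by (simp add: cyc_iff)
  have "bnd (connes x) = (T x - x) - connes (bnd x)"
    using connes_homotopy[OF x] by (simp add: algebra_simps)
  then show ?thesis
    using free_space.subspace_diff[OF subspace_R assms(2) connes_bnd_R[OF assms(1)]] connes_C[OF x]
    by (simp add: cyc_iff)
qed

text \<open>
  Up to relations, an invariant boundary is its own average, hence the boundary of an invariant chain
  \<open>z'\<close>; and \<open>B b z' = - b B z'\<close> because \<open>T z' = z'\<close>.
\<close>

lemma connes_bdr:
  assumes "y \<in> bdr n" "T y - y \<in> R n" shows "connes y \<in> bdr (Suc n)"
proof -
  obtain r z where r: "r \<in> R n" "z \<in> C (Suc n)" "y = r + bnd z"
    using assms(1) bdr_iff by blast
  define z' where "z' = average z"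
  have z': "z' \<in> C (Suc n)" "T z' = z'"
    using r by (simp_all add: z'_def average_C T_average)
  have "average y = average r + bnd z'"
    using r by (simp add: z'_def bnd_average linear_map_add[OF linear_average])
  then have "y = (average r - (average y - y)) + bnd z'" by simp
  moreover have "connes (bnd z') = bnd (- connes z')"
    using connes_homotopy[OF z'(1)] z'(2) by (simp add: linear_map_neg[OF linear_lin_ext] eq_neg_iff_add_eq_0 add.commute)
  ultimately have "connes y = connes (average r - (average y - y)) + bnd (- connes z')"
    by (metis linear_map_add[OF linear_lin_ext])
  moreover have "connes (average r - (average y - y)) \<in> R (Suc n)"
    by (rule connes_R[OF free_space.subspace_diff[OF subspace_R average_R[OF r(1)] average_relation[OF assms(2)]]])
  moreover have "- connes z' \<in> C (Suc (Suc n))"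
    using z'(1) by (intro free_space.subspace_neg[OF subspace_C] connes_C)
  ultimately show ?thesis unfolding bdr_iff by blast
qed

lemma B_nak_eq:
  assumes x: "x \<in> cyc n" "T x - x \<in> R n"
  shows "B_nak scale N n (coset (bdr n) x) = coset (bdr (Suc n)) (connes x)"
  unfolding B_nak_def
proof (rule induced_map_eq[OF bdr_subgroup hoch_homology_def, of _ _ x])
  show "coset (bdr (Suc n)) (connes x) \<in> hoch_homology scale M (Suc n)"
    using connes_cyc[OF x] by (simp add: hoch_homology_def)
  show "x \<in> coset (bdr n) x" by (rule coset_self[OF bdr_subgroup])
  show "x \<in> invariant_chains scale N n"
    using x by (simp add: invariant_chains_def cyc_iff)
  show "connes ` (coset (bdr n) x \<inter> invariant_chains scale N n) \<subseteq> coset (bdr (Suc n)) (connes x)"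
  proof (clarify, unfold mem_coset)
    fix x' assume x': "x' - x \<in> bdr n" "x' \<in> invariant_chains scale N n"
    then have "T x' - x' \<in> R n" by (simp add: invariant_chains_def)
    then have "(T x' - x') - (T x - x) \<in> R n" using x(2) by (rule free_space.subspace_diff[OF subspace_R])
    then have "T (x' - x) - (x' - x) \<in> R n" by (simp add: linear_map_diff[OF linear_lin_ext] algebra_simps)
    from connes_bdr[OF x'(1) this] show "connes x' - connes x \<in> bdr (Suc n)"
      by (simp add: linear_map_diff[OF linear_lin_ext])
  qed
qed

abbreviation volkov :: "('a list \<Rightarrow> 'a) \<Rightarrow> ('a list \<Rightarrow> 'a)" where "volkov \<equiv> volkov_cochain form N"

text \<open>
  The transpose of \<open>average\<close> is homotopic to the identity, so it preserves the class of a cocycle.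
\<close>

lemma equivariant_representative:
  assumes "f \<in> cocyc n"
  obtains f' where "f' \<in> cocyc n" "equivariant f'" "coset (cobdr n) f' = coset (cobdr n) f"
proof -
  have f: "f \<in> coch n" "\<And>y. y \<in> C (Suc n) \<Longrightarrow> pair f (bnd y) = 0"
    using assms by (auto simp: cocycle_iff)
  obtain f' where f': "f' \<in> coch n" "\<And>x. x \<in> C n \<Longrightarrow> pair f' x = pair f (average x)"
    using cochain_pullback[OF f(1) linear_average average_R] by blast
  have "pair (f' - f) x = 0" if x: "x \<in> cyc n" for x
  proof -
    have C: "x \<in> C n" using x by (simp add: cyc_iff)
    then have "pair (f' - f) x = pair f (average x - x)"
      by (simp add: pairing_diff_cochain f'(2) linear_map_diff[OF linear_pairing])
    also have "\<dots> = 0"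
      by (simp add: average_homotopy[OF C] linear_map_add[OF linear_pairing] f(2) homotopy_C[OF C]
          pairing_relation[OF f(1) homotopy_bnd_R[OF x]])
    finally show ?thesis .
  qed
  then have D: "f' - f \<in> cobdr n"
    using f'(1) f(1) by (simp add: coboundary_iff diff_in_coch)
  show thesis
  proof
    show "f' \<in> cocyc n" using coset_cocycle[OF _ assms] D by (simp add: mem_coset)
    show "equivariant f'"
      using f' by (simp add: equivariant_iff T_C average_T T_average)
    show "coset (cobdr n) f' = coset (cobdr n) f" by (rule coset_eqI[OF cobdr_subgroup D])
  qed
qed

text \<open>
  As \<open>f\<close> kills boundaries and is invariant, \<open>f (B b z) = f (T z - z - b B z) = 0\<close>.
\<close>

lemma volkov_cocycle:
  assumes f: "f \<in> cocyc (Suc n)" and inv: "equivariant f"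
  shows "volkov f \<in> cocyc n"
  unfolding cocycle_iff
proof
  have coch: "f \<in> coch (Suc n)" using f by (simp add: cocycle_iff)
  then show "volkov f \<in> coch n" by (rule volkov_cochain_in_coch)
  show "\<forall>z\<in>C (Suc n). pair (volkov f) (bnd z) = 0"
  proof
    fix z assume z: "z \<in> C (Suc n)"
    have "connes (bnd z) = T z - z - bnd (connes z)"
      using connes_homotopy[OF z] by (simp add: algebra_simps)
    then show "pair (volkov f) (bnd z) = 0"
      using f inv z connes_C[OF z]
      by (simp add: pairing_volkov_cochain[OF coch] bnd_C linear_map_diff[OF linear_pairing] cocycle_iff
          equivariant_iff[OF coch])
  qed
qed

text \<open>
  For a cycle \<open>x\<close>, the chain \<open>B x\<close> need not be a cycle, but its average is: \<open>b B x\<close> is \<open>T x - x\<close> up to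
  relations, and averaging kills \<open>T x - x\<close>. As \<open>f\<close> is invariant, it has the same value on \<open>B x\<close> and on
  the average.
\<close>

lemma volkov_coboundary:
  assumes f: "f \<in> cobdr (Suc n)" and inv: "equivariant f"
  shows "volkov f \<in> cobdr n"
  unfolding coboundary_iff
proof
  have coch: "f \<in> coch (Suc n)" using f by (simp add: coboundary_iff)
  then show "volkov f \<in> coch n" by (rule volkov_cochain_in_coch)
  show "\<forall>x\<in>cyc n. pair (volkov f) x = 0"
  proof
    fix x assume x: "x \<in> cyc n"
    then have C: "x \<in> C n" by (simp add: cyc_iff)
    have "average (connes x) \<in> cyc (Suc n)"
    proof -
      have "bnd (average (connes x)) = average (T x - x - connes (bnd x))"
      proof -
        have "bnd (connes x) = T x - x - connes (bnd x)"
          using connes_homotopy[OF C] by (simp add: algebra_simps)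
        then show ?thesis by (simp only: bnd_average[OF connes_C[OF C]])
      qed
      also have "\<dots> = - average (connes (bnd x))"
        by (simp add: linear_map_diff[OF linear_average] average_T T_average)
      finally show ?thesis
        using average_R[OF connes_bnd_R[OF x]] average_C[OF connes_C[OF C]]
        by (simp add: cyc_iff free_space.subspace_neg[OF subspace_R])
    qed
    then have "pair f (average (connes x)) = 0" using f by (simp add: coboundary_iff)
    moreover have "pair f (average (connes x)) = pair f (connes x)"
      using inv by (intro functional_average[OF linear_pairing _ connes_C[OF C]]) (simp add: equivariant_iff[OF coch])
    ultimately show "pair (volkov f) x = 0"
      using pairing_volkov_cochain[OF coch C] by simp
  qed
qed

lemma volkov_diff:
  assumes "f \<in> coch (Suc n)" "g \<in> coch (Suc n)"
  shows "volkov (f - g) = volkov f - volkov g"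
  using volkov_cochain_in_coch[OF assms(1)] volkov_cochain_in_coch[OF assms(2)]
    volkov_cochain_in_coch[OF diff_in_coch[OF assms]]
  by (intro cochain_eqI[of n])
    (simp_all add: coch_iff pairing_diff_cochain pairing_volkov_cochain[OF diff_in_coch[OF assms]]
      pairing_volkov_cochain[OF assms(1)] pairing_volkov_cochain[OF assms(2)])

lemma volkov_class:
  assumes f: "f \<in> cocyc (Suc n)" "equivariant f" and g: "g \<in> coset (cobdr (Suc n)) f" "equivariant g"
  shows "volkov g \<in> coset (cobdr n) (volkov f)"
proof -
  have "f \<in> coch (Suc n)" "g \<in> coch (Suc n)"
    using f coset_cocycle[OF g(1) f(1)] by (simp_all add: cocycle_iff)
  moreover have "equivariant (g - f)"
    using f(2) g(2) by (simp add: equivariant_def linear_map_diff[OF linear_N])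
  ultimately show ?thesis
    using volkov_coboundary[of "g - f" n] g(1) by (simp add: mem_coset volkov_diff)
qed

lemma volkov_delta_eq:
  assumes f: "f \<in> cocyc (Suc n)" "equivariant f"
  shows "volkov_delta scale form N n (coset (cobdr (Suc n)) f) = coset (cobdr n) (volkov f)"
  unfolding volkov_delta_def
  by (rule induced_map_eq[OF cobdr_subgroup hoch_cohomology_def, of _ _ f])
    (use f volkov_class[OF f] volkov_cocycle[OF f] coset_self[OF cobdr_subgroup] in
      \<open>auto simp: hoch_cohomology_def equivariant_def\<close>)

lemma Z_map_equivariant: "(\<forall>as a0. Z_map f (map N as) (N a0) = Z_map f as a0) \<longleftrightarrow> equivariant f"
proof -
  have "(\<forall>a0. form (f (map N as)) (N a0) = form (f as) a0) \<longleftrightarrow> f (map N as) = N (f as)" for as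
  proof
    assume eq: "\<forall>a0. form (f (map N as)) (N a0) = form (f as) a0"
    then have "form (f (map N as)) (N a0) = form (N (f as)) (N a0)" for a0
      by (simp add: form_N_N)
    then show "f (map N as) = N (f as)"
      using bij_N by (intro form_eqI) (metis bij_is_surj surj_def)
  qed (simp add: form_N_N)
  then show ?thesis by (simp add: equivariant_def)
qed

lemma B_bar_eq:
  assumes f: "f \<in> cocyc (Suc n)" "equivariant f"
  shows "B_bar scale N n (Z_map ` coset (cobdr (Suc n)) f) = Z_map ` coset (cobdr n) (volkov f)"
  unfolding B_bar_def
proof (rule induced_map_eq[OF dual_coboundaries_subgroup hoch_cohomology_def, of _ _ "Z_map f"])
  show "Z_map ` coset (cobdr n) (volkov f) \<in> hoch_cohomology scale Md n"
    using volkov_cocycle[OF f] by (auto simp: hoch_cohomology_def[of _ "regular_bimodule scale"] simp flip: Z_map_HH)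
  show "Z_map f \<in> Z_map ` coset (cobdr (Suc n)) f" using coset_self[OF cobdr_subgroup] by blast
  show "Z_map f \<in> {f. \<forall>as a0. f (map N as) (N a0) = f as a0}" using f(2) Z_map_equivariant[of f] by blast
  show "B_bar_cochain N ` (Z_map ` coset (cobdr (Suc n)) f \<inter> {f. \<forall>as a0. f (map N as) (N a0) = f as a0})
      \<subseteq> Z_map ` coset (cobdr n) (volkov f)"
  proof clarify
    fix g assume g: "g \<in> coset (cobdr (Suc n)) f" "\<forall>as a0. Z_map g (map N as) (N a0) = Z_map g as a0"
    then have coch: "g \<in> coch (Suc n)" using coset_cocycle[OF g(1) f(1)] by (simp add: cocycle_iff)
    have "B_bar_cochain N (Z_map g) = Z_map (volkov g)"
      by (simp add: fun_eq_iff B_bar_cochain_def form_volkov_cochain[OF coch])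
    moreover have "volkov g \<in> coset (cobdr n) (volkov f)"
      using volkov_class[OF f g(1)] g(2) Z_map_equivariant by blast
    ultimately show "B_bar_cochain N (Z_map g) \<in> Z_map ` coset (cobdr n) (volkov f)" by blast
  qed
qed

text \<open>
  Evaluate on a class of homology, represented by an invariant cycle \<open>y\<close>: both sides are \<open>\<langle>f, B y\<rangle>\<close>.
\<close>

lemma B_nak_dual_eq:
  assumes f: "f \<in> cocyc (Suc n)" "equivariant f"
  shows "B_nak_dual scale N n (del_inv scale form N (Suc n) (coset (cobdr (Suc n)) f)) =
    del_inv scale form N n (coset (cobdr n) (volkov f))"
proof
  fix h
  have HH: "coset (cobdr (Suc n)) f \<in> HH scale (Suc n)" using f by (simp add: hoch_cohomology_def)
  have coch: "f \<in> coch (Suc n)" using f by (simp add: cocycle_iff)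
  show "B_nak_dual scale N n (del_inv scale form N (Suc n) (coset (cobdr (Suc n)) f)) h =
      del_inv scale form N n (coset (cobdr n) (volkov f)) h"
  proof (cases "h \<in> hoch_homology scale M n")
    case False
    then show ?thesis using del_inv_in_dual[OF HH] by (simp add: B_nak_dual_def del_inv_def)
  next
    case True
    then obtain x where x: "x \<in> cyc n" "h = coset (bdr n) x" by (auto simp: hoch_homology_def)
    define y where "y = average x"
    have y: "y \<in> cyc n" "T y - y \<in> R n" "h = coset (bdr n) y"
      using average_cyc[OF x(1)] free_space.subspace_0[OF subspace_R]
        coset_eqI[OF bdr_subgroup average_homologous[OF x(1)]] x(2)
      by (simp_all add: y_def T_average)
    have "B_nak_dual scale N n (del_inv scale form N (Suc n) (coset (cobdr (Suc n)) f)) h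
        = del_inv scale form N (Suc n) (coset (cobdr (Suc n)) f) (B_nak scale N n h)"
      using del_inv_in_dual[OF HH] True by (simp add: B_nak_dual_def)
    also have "\<dots> = pair f (connes y)"
      by (simp add: y(3) B_nak_eq[OF y(1,2)] del_inv_eq f(1) connes_cyc[OF y(1,2)])
    also have "\<dots> = pair (volkov f) y"
      using y(1) by (simp add: pairing_volkov_cochain[OF coch] cyc_iff)
    also have "\<dots> = del_inv scale form N n (coset (cobdr n) (volkov f)) h"
      by (simp add: y(3) del_inv_eq[OF volkov_cocycle[OF f] y(1)])
    finally show ?thesis .
  qed
qed

lemma bv_operators_agree:
  assumes c: "c \<in> HH scale (Suc n)"
  shows "del scale form N n (B_nak_dual scale N n (del_inv scale form N (Suc n) c)) = volkov_delta scale form N n c"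
    and "Z_star_inv scale form N n (B_bar scale N n (Z_star scale form N (Suc n) c)) = volkov_delta scale form N n c"
proof -
  obtain f0 where "f0 \<in> cocyc (Suc n)" "c = coset (cobdr (Suc n)) f0" by (rule HH_E[OF c])
  then obtain f where f: "f \<in> cocyc (Suc n)" "equivariant f" and c_eq: "c = coset (cobdr (Suc n)) f"
    by (metis equivariant_representative)
  let ?e = "coset (cobdr n) (volkov f)"
  have e: "?e \<in> HH scale n"
    using volkov_cocycle[OF f] by (simp add: hoch_cohomology_def)
  have "del scale form N n (del_inv scale form N n ?e) = ?e"
    using del_inv_in_dual[OF e] inv_into_f_f[OF inj_del_inv e] by (simp add: del_def)
  then show "del scale form N n (B_nak_dual scale N n (del_inv scale form N (Suc n) c)) = volkov_delta scale form N n c"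
    by (simp add: c_eq B_nak_dual_eq[OF f] volkov_delta_eq[OF f])
  show "Z_star_inv scale form N n (B_bar scale N n (Z_star scale form N (Suc n) c)) = volkov_delta scale form N n c"
    using Z_star_eq[OF c] Z_star_inv_eq[OF e] by (simp add: c_eq B_bar_eq[OF f] volkov_delta_eq[OF f])
qed

end

theorem mainTheorem7:
  fixes scale :: "'k::alg_closed_field \<Rightarrow> 'a::{ring, monoid_mult} \<Rightarrow> 'a"
    and form :: "'a \<Rightarrow> 'a \<Rightarrow> 'k" and N :: "'a \<Rightarrow> 'a" and n :: nat
    and c :: "('a list \<Rightarrow> 'a) set"
  assumes "frobenius_algebra scale form"
    and "nakayama_automorphism scale form N"
    and "has_finite_order N"
    and "\<not> CHAR('k) dvd automorphism_order N"
    and "c \<in> HH scale (Suc n)"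
  shows "del scale form N n (B_nak_dual scale N n (del_inv scale form N (Suc n) c))
           = Z_star_inv scale form N n (B_bar scale N n (Z_star scale form N (Suc n) c))
       \<and> Z_star_inv scale form N n (B_bar scale N n (Z_star scale form N (Suc n) c))
           = volkov_delta scale form N n c"
proof -
  have "N ^^ automorphism_order N = id"
    using assms(3) unfolding has_finite_order_def automorphism_order_def
    by (metis (mono_tags, lifting) LeastI_ex)
  then interpret averaging_algebra scale form N "automorphism_order N"
    using assms(1,2,4)
    by (simp add: averaging_algebra_def averaging_algebra_axioms_def nakayama_algebra_def
        nakayama_algebra_axioms_def of_nat_eq_0_iff_char_dvd)
  show ?thesis
    using bv_operators_agree[OF assms(5)] by simp
qed

end
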